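(* Let $S$ be a ring, let $C$ be a multiplicatively closed subset of nonzerodivisors of $S$, let $R$ be a subring of $S$ that is twisted along $C$ by a $C$-torsion-free $S$-module $K$, and let $D$ be the derivation that twists $R$. If $R$ and $S$ are quasilocal, each with finitely generated maximal ideal meeting $C$, then the ring homomorphism $f:R\to S\star K$, $f(r)=(r,D(r))$, lifts to an isomorphism of rings $\widehat{R}\to\widehat{S}\star\widehat{K}$, where $\widehat{R}$ is the completion of $R$ in the topology defined by the powers of its maximal ideal, and $\widehat{S}$ and $\widehat{K}$ are the completions of $S$ and $K$ in the topology defined by the powers of the maximal ideal of $S$.
   Context: All rings are commutative with identity. A ring is quasilocal if it has a unique maximal ideal. A derivation $D$ from a ring $B$ to a $B$-module $L$ is an additive map with $D(st)=sD(t)+tD(s)$; it is $C$-linear for a subset $C\subseteq B$ if $D(C)=0$. For a multiplicatively closed set $C$, $S_C$ and $K_C$ denote localizations at $C$. An $S$-module $L$ is $C$-torsion-free if $c\ell=0$ with $c\in C$, $\ell\in L$ implies $\ell=0$. Twisted: let $S$ be a ring, $K$ an $S$-module, and $C$ a multiplicatively closed subset of nonzerodivisors of $S$ that are also nonzerodivisors on $K$. A subring $R$ of $S$ is twisted by $K$ along $C$ if there is a $C$-linear derivation $D:S_C\to K_C$ such that (a) $R=S\cap D^{-1}(K)$; (b) $D(S_C)$ generates $K_C$ as an $S_C$-module; (c) $S\subseteq \operatorname{Ker} D+cS$ for all $c\in C$. Such a $D$ is said to twist $R$ by $K$ along $C$. Idealization: for a ring $A$ and $A$-module $L$, $A\star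 L$ is the abelian group $A\oplus L$ with multiplication $(a_1,\ell_1)(a_2,\ell_2)=(a_1a_2,a_1\ell_2+a_2\ell_1)$. *)

theory Defs
  imports "HOL-Algebra.Module" "HOL-Algebra.Subrings" "HOL-Algebra.Ideal_Product"
begin

section \<open>Quasilocal rings\<close>

definition quasilocal :: "('a, 'm) ring_scheme \<Rightarrow> bool"
  where "quasilocal A \<longleftrightarrow> cring A \<and> (\<exists>!m. maximalideal m A)"

definition fg_ideal :: "('a, 'm) ring_scheme \<Rightarrow> 'a set \<Rightarrow> bool"
  where "fg_ideal A I \<longleftrightarrow> (\<exists>G \<subseteq> carrier A. finite G \<and> I = Idl\<^bsub>A\<^esub> G)"

section \<open>Modules\<close>

definition gen_submodule :: "('a, 'm) ring_scheme \<Rightarrow> ('a, 'b, 'n) module_scheme \<Rightarrow> 'b set \<Rightarrow> 'b set"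
  where "gen_submodule A L X = (\<lambda>H. submodule H A L) hull X"

definition ring_nonzerodivisors :: "('a, 'm) ring_scheme \<Rightarrow> 'a set"
  where "ring_nonzerodivisors A =
    {c \<in> carrier A. \<forall>s\<in>carrier A. c \<otimes>\<^bsub>A\<^esub> s = \<zero>\<^bsub>A\<^esub> \<longrightarrow> s = \<zero>\<^bsub>A\<^esub>}"

definition torsion_free :: "'a set \<Rightarrow> ('a, 'b, 'n) module_scheme \<Rightarrow> bool"
  where "torsion_free C L \<longleftrightarrow>
    (\<forall>c\<in>C. \<forall>l\<in>carrier L. c \<odot>\<^bsub>L\<^esub> l = \<zero>\<^bsub>L\<^esub> \<longrightarrow> l = \<zero>\<^bsub>L\<^esub>)"

definition regular_module :: "('a, 'm) ring_scheme \<Rightarrow> ('a, 'a) module"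
  where "regular_module A =
    \<lparr>carrier = carrier A, mult = mult A, one = one A, zero = zero A, add = add A, smult = mult A\<rparr>"

definition derivation :: "('a, 'm) ring_scheme \<Rightarrow> ('a, 'b, 'n) module_scheme \<Rightarrow> ('a \<Rightarrow> 'b) \<Rightarrow> bool"
  where "derivation B L D \<longleftrightarrow>
    D \<in> carrier B \<rightarrow> carrier L \<and>
    (\<forall>s\<in>carrier B. \<forall>t\<in>carrier B. D (s \<oplus>\<^bsub>B\<^esub> t) = D s \<oplus>\<^bsub>L\<^esub> D t) \<and>
    (\<forall>s\<in>carrier B. \<forall>t\<in>carrier B.
       D (s \<otimes>\<^bsub>B\<^esub> t) = (s \<odot>\<^bsub>L\<^esub> D t) \<oplus>\<^bsub>L\<^esub> (t \<odot>\<^bsub>L\<^esub> D s))"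

definition linear_over :: "'a set \<Rightarrow> ('a, 'b, 'n) module_scheme \<Rightarrow> ('a \<Rightarrow> 'b) \<Rightarrow> bool"
  where "linear_over C L D \<longleftrightarrow> (\<forall>c\<in>C. D c = \<zero>\<^bsub>L\<^esub>)"

section \<open>Localization\<close>

text \<open>The fraction \<open>x / c\<close> is the class of the pair \<open>(x, c)\<close>, where \<open>(x, c)\<close> and \<open>(y, d)\<close> are
  equivalent iff \<open>t (d x - c y) = 0\<close> for some \<open>t \<in> C\<close>.  The operations on classes
  are unions over all representatives, in the style of \<^const>\<open>rcoset_mult\<close>.\<close>

definition frac :: "('a, 'm) ring_scheme \<Rightarrow> ('a, 'b, 'n) module_scheme \<Rightarrow> 'a set \<Rightarrow> 'b \<Rightarrow> 'a \<Rightarrow> ('b \<times> 'a) set"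
  where "frac S K C x c =
    {(y, d). y \<in> carrier K \<and> d \<in> C \<and>
       (\<exists>t\<in>C. (t \<otimes>\<^bsub>S\<^esub> d) \<odot>\<^bsub>K\<^esub> x = (t \<otimes>\<^bsub>S\<^esub> c) \<odot>\<^bsub>K\<^esub> y)}"

text \<open>The fields \<^const>\<open>mult\<close> and \<^const>\<open>one\<close> of a module record carry no information.\<close>

definition loc_module :: "('a, 'm) ring_scheme \<Rightarrow> ('a, 'b, 'n) module_scheme \<Rightarrow> 'a set
    \<Rightarrow> (('a \<times> 'a) set, ('b \<times> 'a) set) module"
  where "loc_module S K C =
    \<lparr>carrier = {frac S K C x c | x c. x \<in> carrier K \<and> c \<in> C},
     mult = undefined,
     one = undefined,
     zero = frac S K C \<zero>\<^bsub>K\<^esub> \<one>\<^bsub>S\<^esub>,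
     add = (\<lambda>X Y. \<Union>(x, c)\<in>X. \<Union>(y, d)\<in>Y.
       frac S K C ((d \<odot>\<^bsub>K\<^esub> x) \<oplus>\<^bsub>K\<^esub> (c \<odot>\<^bsub>K\<^esub> y)) (c \<otimes>\<^bsub>S\<^esub> d)),
     smult = (\<lambda>A X. \<Union>(s, c)\<in>A. \<Union>(x, d)\<in>X. frac S K C (s \<odot>\<^bsub>K\<^esub> x) (c \<otimes>\<^bsub>S\<^esub> d))\<rparr>"

abbreviation rfrac :: "('a, 'm) ring_scheme \<Rightarrow> 'a set \<Rightarrow> 'a \<Rightarrow> 'a \<Rightarrow> ('a \<times> 'a) set"
  where "rfrac S \<equiv> frac S (regular_module S)"

definition loc_ring :: "('a, 'm) ring_scheme \<Rightarrow> 'a set \<Rightarrow> ('a \<times> 'a) set ring"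
  where "loc_ring S C =
    \<lparr>carrier = {rfrac S C s c | s c. s \<in> carrier S \<and> c \<in> C},
     mult = (\<lambda>A B. \<Union>(s, c)\<in>A. \<Union>(t, d)\<in>B. rfrac S C (s \<otimes>\<^bsub>S\<^esub> t) (c \<otimes>\<^bsub>S\<^esub> d)),
     one = rfrac S C \<one>\<^bsub>S\<^esub> \<one>\<^bsub>S\<^esub>,
     zero = rfrac S C \<zero>\<^bsub>S\<^esub> \<one>\<^bsub>S\<^esub>,
     add = (\<lambda>A B. \<Union>(s, c)\<in>A. \<Union>(t, d)\<in>B.
       rfrac S C ((d \<otimes>\<^bsub>S\<^esub> s) \<oplus>\<^bsub>S\<^esub> (c \<otimes>\<^bsub>S\<^esub> t)) (c \<otimes>\<^bsub>S\<^esub> d))\<rparr>"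

text \<open>The canonical maps \<open>S \<rightarrow> S\<^sub>C\<close> and \<open>K \<rightarrow> K\<^sub>C\<close>; both are injective when \<open>C\<close> consists of
  nonzerodivisors on \<open>S\<close> and on \<open>K\<close>.\<close>

definition loc_ring_incl :: "('a, 'm) ring_scheme \<Rightarrow> 'a set \<Rightarrow> 'a \<Rightarrow> ('a \<times> 'a) set"
  where "loc_ring_incl S C s = rfrac S C s \<one>\<^bsub>S\<^esub>"

definition loc_module_incl ::
    "('a, 'm) ring_scheme \<Rightarrow> ('a, 'b, 'n) module_scheme \<Rightarrow> 'a set \<Rightarrow> 'b \<Rightarrow> ('b \<times> 'a) set"
  where "loc_module_incl S K C k = frac S K C k \<one>\<^bsub>S\<^esub>"

section \<open>Twisted subrings\<close>

definition twists :: "('a, 'm) ring_scheme \<Rightarrow> ('a, 'b, 'n) module_scheme \<Rightarrow> 'a set \<Rightarrow> 'a set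
    \<Rightarrow> (('a \<times> 'a) set \<Rightarrow> ('b \<times> 'a) set) \<Rightarrow> bool"
  where "twists S K C R D \<longleftrightarrow>
    (let SC = loc_ring S C; KC = loc_module S K C;
         i = loc_ring_incl S C; j = loc_module_incl S K C
     in derivation SC KC D \<and> linear_over (i ` C) KC D \<and>
        R = {s \<in> carrier S. D (i s) \<in> j ` carrier K} \<and>
        gen_submodule SC KC (D ` carrier SC) = carrier KC \<and>
        (\<forall>c\<in>C. i ` carrier S \<subseteq> a_kernel SC KC D <+>\<^bsub>SC\<^esub> i ` (PIdl\<^bsub>S\<^esub> c)))"

section \<open>Idealization\<close>

definition idealization :: "('a, 'm) ring_scheme \<Rightarrow> ('a, 'b, 'n) module_scheme \<Rightarrow> ('a \<times> 'b) ring"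
  where "idealization A L =
    \<lparr>carrier = carrier A \<times> carrier L,
     mult = (\<lambda>(a, k) (b, l). (a \<otimes>\<^bsub>A\<^esub> b, (a \<odot>\<^bsub>L\<^esub> l) \<oplus>\<^bsub>L\<^esub> (b \<odot>\<^bsub>L\<^esub> k))),
     one = (\<one>\<^bsub>A\<^esub>, \<zero>\<^bsub>L\<^esub>),
     zero = (\<zero>\<^bsub>A\<^esub>, \<zero>\<^bsub>L\<^esub>),
     add = (\<lambda>(a, k) (b, l). (a \<oplus>\<^bsub>A\<^esub> b, k \<oplus>\<^bsub>L\<^esub> l))\<rparr>"

text \<open>For \<open>r \<in> R\<close>, \<open>D (r / 1)\<close> lies in the image of \<open>K\<close> in \<open>K\<^sub>C\<close>; the second component is the
  unique element of \<open>K\<close> it comes from.\<close>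

definition twist_map :: "('a, 'm) ring_scheme \<Rightarrow> ('a, 'b, 'n) module_scheme \<Rightarrow> 'a set
    \<Rightarrow> (('a \<times> 'a) set \<Rightarrow> ('b \<times> 'a) set) \<Rightarrow> 'a \<Rightarrow> 'a \<times> 'b"
  where "twist_map S K C D r =
    (r, THE k. k \<in> carrier K \<and> loc_module_incl S K C k = D (loc_ring_incl S C r))"

section \<open>Adic completion\<close>

text \<open>The completion of \<open>A\<close> is the inverse limit of the rings \<open>A / I\<^sup>n\<close>, realized as the ring of
  sequences of cosets \<open>x n\<close> of \<open>I\<^sup>n\<close>.  As \<open>I\<^sup>n\<^sup>+\<^sup>1 \<subseteq> I\<^sup>n\<close>, the transition map sends a coset
  of \<open>I\<^sup>n\<^sup>+\<^sup>1\<close> to the coset of \<open>I\<^sup>n\<close> containing it, so compatibility is the inclusion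
  \<open>x (n + 1) \<subseteq> x n\<close>.  Likewise for a module \<open>L\<close> and the quotients \<open>L / I\<^sup>n L\<close>.\<close>

definition ideal_power :: "('a, 'm) ring_scheme \<Rightarrow> 'a set \<Rightarrow> nat \<Rightarrow> 'a set"
  where "ideal_power A I n = I [^]\<^bsub>ideals_set A\<^esub> n"

definition ideal_power_module ::
    "('a, 'm) ring_scheme \<Rightarrow> ('a, 'b, 'n) module_scheme \<Rightarrow> 'a set \<Rightarrow> nat \<Rightarrow> 'b set"
  where "ideal_power_module A L I n =
    gen_submodule A L {a \<odot>\<^bsub>L\<^esub> l | a l. a \<in> ideal_power A I n \<and> l \<in> carrier L}"

definition ring_completion :: "('a, 'm) ring_scheme \<Rightarrow> 'a set \<Rightarrow> (nat \<Rightarrow> 'a set) ring"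
  where "ring_completion A I =
    \<lparr>carrier = {x. \<forall>n. x n \<in> carrier (A Quot ideal_power A I n) \<and> x (Suc n) \<subseteq> x n},
     mult = (\<lambda>x y n. x n \<otimes>\<^bsub>A Quot ideal_power A I n\<^esub> y n),
     one = (\<lambda>n. \<one>\<^bsub>A Quot ideal_power A I n\<^esub>),
     zero = (\<lambda>n. \<zero>\<^bsub>A Quot ideal_power A I n\<^esub>),
     add = (\<lambda>x y n. x n \<oplus>\<^bsub>A Quot ideal_power A I n\<^esub> y n)\<rparr>"

definition module_completion :: "('a, 'm) ring_scheme \<Rightarrow> ('a, 'b, 'n) module_scheme \<Rightarrow> 'a set
    \<Rightarrow> (nat \<Rightarrow> 'a set, nat \<Rightarrow> 'b set) module"
  where "module_completion A L I =
    \<lparr>carrier = {y. \<forall>n. y n \<in> a_rcosets\<^bsub>L\<^esub> (ideal_power_module A L I n) \<and> y (Suc n) \<subseteq> y n},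
     mult = undefined,
     one = undefined,
     zero = (\<lambda>n. ideal_power_module A L I n),
     add = (\<lambda>y z n. y n <+>\<^bsub>L\<^esub> z n),
     smult = (\<lambda>x y n. \<Union>a\<in>x n. \<Union>l\<in>y n. ideal_power_module A L I n +>\<^bsub>L\<^esub> (a \<odot>\<^bsub>L\<^esub> l))\<rparr>"

definition to_ring_completion :: "('a, 'm) ring_scheme \<Rightarrow> 'a set \<Rightarrow> 'a \<Rightarrow> nat \<Rightarrow> 'a set"
  where "to_ring_completion A I a = (\<lambda>n. ideal_power A I n +>\<^bsub>A\<^esub> a)"

definition to_module_completion ::
    "('a, 'm) ring_scheme \<Rightarrow> ('a, 'b, 'n) module_scheme \<Rightarrow> 'a set \<Rightarrow> 'b \<Rightarrow> nat \<Rightarrow> 'b set"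
  where "to_module_completion A L I l = (\<lambda>n. ideal_power_module A L I n +>\<^bsub>L\<^esub> l)"

end

theory Submission
  imports Defs
begin

text \<open>Write \<open>\<delta>\<close> for \<open>D\<close> restricted to \<open>R \<rightarrow> K\<close>, \<open>m\<close> and \<open>M\<close> for the maximal ideals of \<open>R\<close> and \<open>S\<close>, and
  \<open>f r = (r, \<delta> r)\<close>. Because \<open>D\<close> is \<open>C\<close>-linear, \<open>f\<close> induces an injection
  \<open>R / c R \<rightarrow> (S \<star> K) / c (S \<star> K)\<close> for every \<open>c \<in> C\<close>. It is onto because \<open>K\<^sub>C = D S + K\<close>: a multiple
  \<open>(a / d) D u\<close> is rewritten by splitting numerators into an element of \<open>Ker D\<close> and a multiple of
  the denominators.
  Taking \<open>c \<in> M \<inter> C\<close>, surjectivity shows that \<open>M \<inter> R\<close> is maximal, so it is \<open>m\<close>, and that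
  \<open>R / m\<^sup>n \<cong> (S \<star> K) / f(m\<^sup>n) (S \<star> K)\<close>, as \<open>c\<^sup>n \<in> m\<^sup>n\<close>. The filtrations
  \<open>f(m\<^sup>n) (S \<star> K)\<close> and \<open>M\<^sup>n \<star> M\<^sup>n K\<close> interleave with a shift by one, hence they have
  the same completion.\<close>

section \<open>Auxiliary facts on modules and on the regular module\<close>

lemma (in module) smult_left_commute:
  assumes "a \<in> carrier R" "b \<in> carrier R" "x \<in> carrier M"
  shows "a \<odot>\<^bsub>M\<^esub> (b \<odot>\<^bsub>M\<^esub> x) = b \<odot>\<^bsub>M\<^esub> (a \<odot>\<^bsub>M\<^esub> x)"
  using assms by (metis R.m_comm smult_assoc1)

lemma (in cring) regular_module_module: "module R (regular_module R)"
proof (rule moduleI)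
  show "abelian_group (regular_module R)"
    by (rule abelian_groupI)
      (use a_assoc a_comm l_neg in \<open>auto simp: regular_module_def intro!: bexI[of _ "\<ominus> _"]\<close>)
qed (auto simp: regular_module_def l_distr r_distr m_assoc is_cring)

lemma regular_module_simps [simp]:
  "carrier (regular_module A) = carrier A"
  "add (regular_module A) = add A"
  "zero (regular_module A) = zero A"
  "smult (regular_module A) = mult A"
  by (simp_all add: regular_module_def)

lemma torsion_free_regular_module:
  "C \<subseteq> ring_nonzerodivisors A \<Longrightarrow> torsion_free C (regular_module A)"
  by (auto simp: torsion_free_def ring_nonzerodivisors_def)

lemma UN_const_eq: "A \<noteq> {} \<Longrightarrow> (\<And>a. a \<in> A \<Longrightarrow> f a = B) \<Longrightarrow> (\<Union>a\<in>A. f a) = B"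
  by auto

section \<open>Localization of torsion-free modules\<close>

locale torsion_free_module = module S K for S (structure) and K (structure) +
  fixes C
  assumes C_submonoid: "submonoid C S"
    and C_nzd: "C \<subseteq> ring_nonzerodivisors S"
    and K_tf: "torsion_free C K"
begin

lemma C_carrier [simp]: "c \<in> C \<Longrightarrow> c \<in> carrier S"
  using submonoid.subset[OF C_submonoid] by blast

lemma one_C [simp]: "\<one> \<in> C"
  using submonoid.one_closed[OF C_submonoid] .

lemma mult_C [simp]: "c \<in> C \<Longrightarrow> d \<in> C \<Longrightarrow> c \<otimes> d \<in> C"
  using submonoid.m_closed[OF C_submonoid] .

lemma pow_C [simp]: "c \<in> C \<Longrightarrow> c [^] (n::nat) \<in> C"
  by (induction n) auto

lemma C_cancel:
  assumes "c \<in> C" "x \<in> carrier K" "y \<in> carrier K" "c \<odot>\<^bsub>K\<^esub> x = c \<odot>\<^bsub>K\<^esub> y"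
  shows "x = y"
proof -
  have "c \<odot>\<^bsub>K\<^esub> (x \<ominus>\<^bsub>K\<^esub> y) = \<zero>\<^bsub>K\<^esub>"
    using assms by (simp add: M.minus_eq smult_r_distr smult_r_minus M.r_neg)
  then have "x \<ominus>\<^bsub>K\<^esub> y = \<zero>\<^bsub>K\<^esub>"
    using assms K_tf unfolding torsion_free_def by simp
  then show ?thesis
    using assms by (metis M.add.inv_closed M.minus_eq M.minus_equality M.minus_minus)
qed

text \<open>Torsion-freeness cancels the factor \<open>t\<close> from the definition of
  \<open>frac\<close>, and conversely \<open>t = \<one>\<close> will do, so fractions are compared
  by plain cross-multiplication.\<close>

lemma frac_eq:
  assumes "x \<in> carrier K" "c \<in> C"
  shows "frac S K C x c = {(y, d). y \<in> carrier K \<and> d \<in> C \<and> d \<odot>\<^bsub>K\<^esub> x = c \<odot>\<^bsub>K\<^esub> y}"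
proof -
  have "d \<odot>\<^bsub>K\<^esub> x = c \<odot>\<^bsub>K\<^esub> y \<longleftrightarrow>
      (\<exists>t\<in>C. (t \<otimes> d) \<odot>\<^bsub>K\<^esub> x = (t \<otimes> c) \<odot>\<^bsub>K\<^esub> y)" if "y \<in> carrier K" "d \<in> C" for y d
  proof
    assume "d \<odot>\<^bsub>K\<^esub> x = c \<odot>\<^bsub>K\<^esub> y"
    then show "\<exists>t\<in>C. (t \<otimes> d) \<odot>\<^bsub>K\<^esub> x = (t \<otimes> c) \<odot>\<^bsub>K\<^esub> y"
      using assms that by (intro bexI[of _ \<one>]) auto
  next
    assume "\<exists>t\<in>C. (t \<otimes> d) \<odot>\<^bsub>K\<^esub> x = (t \<otimes> c) \<odot>\<^bsub>K\<^esub> y"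
    then obtain t where "t \<in> C" "(t \<otimes> d) \<odot>\<^bsub>K\<^esub> x = (t \<otimes> c) \<odot>\<^bsub>K\<^esub> y"
      by blast
    then show "d \<odot>\<^bsub>K\<^esub> x = c \<odot>\<^bsub>K\<^esub> y"
      using assms that by (simp add: smult_assoc1 C_cancel[of t])
  qed
  then show ?thesis
    unfolding frac_def by auto
qed

lemma frac_self: "x \<in> carrier K \<Longrightarrow> c \<in> C \<Longrightarrow> (x, c) \<in> frac S K C x c"
  by (simp add: frac_eq)

text \<open>Transitivity of cross-multiplication: the two sides agree after multiplication by the
  middle denominator \<open>c\<close>, which is then cancelled.\<close>

lemma frac_eqI:
  assumes "x \<in> carrier K" "c \<in> C" "y \<in> carrier K" "d \<in> C" "d \<odot>\<^bsub>K\<^esub> x = c \<odot>\<^bsub>K\<^esub> y"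
  shows "frac S K C x c = frac S K C y d"
proof -
  \<comment> \<open>Stated for arbitrary fractions because it is applied in both directions.\<close>
  have *: "e \<odot>\<^bsub>K\<^esub> y = d \<odot>\<^bsub>K\<^esub> z"
    if "x \<in> carrier K" "c \<in> C" "y \<in> carrier K" "d \<in> C" "d \<odot>\<^bsub>K\<^esub> x = c \<odot>\<^bsub>K\<^esub> y"
      and "z \<in> carrier K" "e \<in> C" "e \<odot>\<^bsub>K\<^esub> x = c \<odot>\<^bsub>K\<^esub> z" for x y c d e z
  proof (rule C_cancel[of c])
    have "c \<odot>\<^bsub>K\<^esub> (e \<odot>\<^bsub>K\<^esub> y) = e \<odot>\<^bsub>K\<^esub> (d \<odot>\<^bsub>K\<^esub> x)"
      using that by (simp add: smult_left_commute)
    also have "\<dots> = c \<odot>\<^bsub>K\<^esub> (d \<odot>\<^bsub>K\<^esub> z)"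
      using that by (metis C_carrier smult_left_commute)
    finally show "c \<odot>\<^bsub>K\<^esub> (e \<odot>\<^bsub>K\<^esub> y) = c \<odot>\<^bsub>K\<^esub> (d \<odot>\<^bsub>K\<^esub> z)" .
  qed (use that in auto)
  have "e \<odot>\<^bsub>K\<^esub> x = c \<odot>\<^bsub>K\<^esub> z \<longleftrightarrow> e \<odot>\<^bsub>K\<^esub> y = d \<odot>\<^bsub>K\<^esub> z" if "z \<in> carrier K" "e \<in> C" for z e
    using *[OF assms that] *[OF assms(3,4,1,2) assms(5)[symmetric] that] by blast
  then show ?thesis
    using assms(1-4) by (auto simp only: frac_eq)
qed

lemma frac_eq_iff:
  assumes "x \<in> carrier K" "c \<in> C" "y \<in> carrier K" "d \<in> C"
  shows "frac S K C x c = frac S K C y d \<longleftrightarrow> d \<odot>\<^bsub>K\<^esub> x = c \<odot>\<^bsub>K\<^esub> y"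
proof
  assume "frac S K C x c = frac S K C y d"
  then have "(x, c) \<in> frac S K C y d"
    using frac_self assms by auto
  then show "d \<odot>\<^bsub>K\<^esub> x = c \<odot>\<^bsub>K\<^esub> y"
    using assms by (simp add: frac_eq)
qed (rule frac_eqI[OF assms])

text \<open>Makes \<open>S\<close> itself an instance of the locale, so that facts on the
  localization of \<open>K\<close> specialize to that of \<open>S\<close>.\<close>

lemma regular: "torsion_free_module S (regular_module S) C"
  by (simp add: torsion_free_module_def torsion_free_module_axioms_def regular_module_module
      C_submonoid C_nzd torsion_free_regular_module)

lemma carrier_loc_module: "carrier (loc_module S K C) = {frac S K C x c | x c. x \<in> carrier K \<and> c \<in> C}"
  by (simp add: loc_module_def)

lemma loc_module_cases:
  assumes "X \<in> carrier (loc_module S K C)"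
  obtains x c where "x \<in> carrier K" "c \<in> C" "X = frac S K C x c"
  using assms by (auto simp: carrier_loc_module)

lemma frac_carrier [simp]: "x \<in> carrier K \<Longrightarrow> c \<in> C \<Longrightarrow> frac S K C x c \<in> carrier (loc_module S K C)"
  by (auto simp: carrier_loc_module)

lemma zero_loc_module: "\<zero>\<^bsub>loc_module S K C\<^esub> = frac S K C \<zero>\<^bsub>K\<^esub> \<one>"
  by (simp add: loc_module_def)

text \<open>The sum is a union over all pairs of representatives. Every pair gives the same class,
  so the union of this nonempty constant family is that class; \<open>smult_frac\<close> follows the
  same pattern.\<close>

lemma add_frac:
  assumes "x \<in> carrier K" "c \<in> C" "y \<in> carrier K" "d \<in> C"
  shows "frac S K C x c \<oplus>\<^bsub>loc_module S K C\<^esub> frac S K C y d =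
    frac S K C ((d \<odot>\<^bsub>K\<^esub> x) \<oplus>\<^bsub>K\<^esub> (c \<odot>\<^bsub>K\<^esub> y)) (c \<otimes> d)"
proof -
  have eq: "frac S K C ((d' \<odot>\<^bsub>K\<^esub> x') \<oplus>\<^bsub>K\<^esub> (c' \<odot>\<^bsub>K\<^esub> y')) (c' \<otimes> d') =
     frac S K C ((d \<odot>\<^bsub>K\<^esub> x) \<oplus>\<^bsub>K\<^esub> (c \<odot>\<^bsub>K\<^esub> y)) (c \<otimes> d)"
    if "(x', c') \<in> frac S K C x c" "(y', d') \<in> frac S K C y d" for x' y' c' d'
  proof -
    have x': "x' \<in> carrier K" "c' \<in> C" "c' \<odot>\<^bsub>K\<^esub> x = c \<odot>\<^bsub>K\<^esub> x'"
      and y': "y' \<in> carrier K" "d' \<in> C" "d' \<odot>\<^bsub>K\<^esub> y = d \<odot>\<^bsub>K\<^esub> y'"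
      using that assms by (auto simp: frac_eq)
    have "(c \<otimes> d) \<odot>\<^bsub>K\<^esub> (d' \<odot>\<^bsub>K\<^esub> x' \<oplus>\<^bsub>K\<^esub> c' \<odot>\<^bsub>K\<^esub> y') =
        d \<odot>\<^bsub>K\<^esub> (d' \<odot>\<^bsub>K\<^esub> (c \<odot>\<^bsub>K\<^esub> x')) \<oplus>\<^bsub>K\<^esub> c \<odot>\<^bsub>K\<^esub> (c' \<odot>\<^bsub>K\<^esub> (d \<odot>\<^bsub>K\<^esub> y'))"
      using assms x' y' by (simp add: smult_r_distr smult_assoc1 smult_left_commute)
    also have "\<dots> = d \<odot>\<^bsub>K\<^esub> (d' \<odot>\<^bsub>K\<^esub> (c' \<odot>\<^bsub>K\<^esub> x)) \<oplus>\<^bsub>K\<^esub> c \<odot>\<^bsub>K\<^esub> (c' \<odot>\<^bsub>K\<^esub> (d' \<odot>\<^bsub>K\<^esub> y))"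
      using x' y' by simp
    also have "\<dots> = (c' \<otimes> d') \<odot>\<^bsub>K\<^esub> (d \<odot>\<^bsub>K\<^esub> x \<oplus>\<^bsub>K\<^esub> c \<odot>\<^bsub>K\<^esub> y)"
      using assms x'(1,2) y'(1,2) by (simp add: smult_r_distr smult_assoc1 smult_left_commute)
    finally show ?thesis
      by (rule frac_eqI[rotated 4]) (use assms x'(1,2) y'(1,2) in auto)
  qed
  have ne: "frac S K C x c \<noteq> {}" "frac S K C y d \<noteq> {}"
    using frac_self assms by blast+
  show ?thesis
    unfolding loc_module_def
    by (simp, intro UN_const_eq ne) (auto intro!: UN_const_eq ne simp: eq)
qed

lemma smult_frac:
  assumes "s \<in> carrier S" "c \<in> C" "x \<in> carrier K" "d \<in> C"
  shows "rfrac S C s c \<odot>\<^bsub>loc_module S K C\<^esub> frac S K C x d = frac S K C (s \<odot>\<^bsub>K\<^esub> x) (c \<otimes> d)"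
proof -
  interpret reg: torsion_free_module S "regular_module S" C
    by (rule regular)
  have eq: "frac S K C (s' \<odot>\<^bsub>K\<^esub> x') (c' \<otimes> d') = frac S K C (s \<odot>\<^bsub>K\<^esub> x) (c \<otimes> d)"
    if "(s', c') \<in> rfrac S C s c" "(x', d') \<in> frac S K C x d" for s' c' x' d'
  proof -
    have s': "s' \<in> carrier S" "c' \<in> C" "c' \<otimes> s = c \<otimes> s'"
      and x': "x' \<in> carrier K" "d' \<in> C" "d' \<odot>\<^bsub>K\<^esub> x = d \<odot>\<^bsub>K\<^esub> x'"
      using that assms by (auto simp: frac_eq reg.frac_eq)
    have "(c \<otimes> d) \<odot>\<^bsub>K\<^esub> (s' \<odot>\<^bsub>K\<^esub> x') = (c \<otimes> s') \<odot>\<^bsub>K\<^esub> (d \<odot>\<^bsub>K\<^esub> x')"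
      using assms s' x' by (simp add: smult_assoc1 smult_left_commute)
    also have "\<dots> = (c' \<otimes> s) \<odot>\<^bsub>K\<^esub> (d' \<odot>\<^bsub>K\<^esub> x)"
      using s' x' by simp
    also have "\<dots> = (c' \<otimes> d') \<odot>\<^bsub>K\<^esub> (s \<odot>\<^bsub>K\<^esub> x)"
      using assms s'(1,2) x'(1,2) by (simp add: smult_assoc1 smult_left_commute)
    finally show ?thesis
      by (rule frac_eqI[rotated 4]) (use assms s'(1,2) x'(1,2) in auto)
  qed
  have ne: "rfrac S C s c \<noteq> {}" "frac S K C x d \<noteq> {}"
    using frac_self[OF assms(3,4)] reg.frac_self[of s c] assms(1,2) by auto
  show ?thesis
    unfolding loc_module_def
    by (simp, intro UN_const_eq ne) (auto intro!: UN_const_eq ne simp: eq)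
qed

lemma abelian_group_loc_module: "abelian_group (loc_module S K C)"
proof (rule abelian_groupI)
  show "\<exists>Y\<in>carrier (loc_module S K C). Y \<oplus>\<^bsub>loc_module S K C\<^esub> X = \<zero>\<^bsub>loc_module S K C\<^esub>"
    if "X \<in> carrier (loc_module S K C)" for X
  proof -
    obtain x c where X: "x \<in> carrier K" "c \<in> C" "X = frac S K C x c"
      using \<open>X \<in> _\<close> by (auto simp: carrier_loc_module)
    then show ?thesis
      by (intro bexI[of _ "frac S K C (\<ominus>\<^bsub>K\<^esub> x) c"])
        (auto simp: carrier_loc_module zero_loc_module add_frac smult_r_minus M.l_neg frac_eq_iff)
  qed
qed (auto elim!: loc_module_cases simp: zero_loc_module add_frac smult_r_distr smult_assoc1
       smult_left_commute M.a_ac m_ac)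

end

text \<open>Operation by operation, the localized ring is the localization of the regular module,
  with scalar multiplication as its product.\<close>

lemma loc_ring_simps:
  "carrier (loc_ring S C) = carrier (loc_module S (regular_module S) C)"
  "add (loc_ring S C) = add (loc_module S (regular_module S) C)"
  "zero (loc_ring S C) = zero (loc_module S (regular_module S) C)"
  "mult (loc_ring S C) = smult (loc_module S (regular_module S) C)"
  "one (loc_ring S C) = rfrac S C \<one>\<^bsub>S\<^esub> \<one>\<^bsub>S\<^esub>"
  by (simp_all add: loc_ring_def loc_module_def regular_module_def)

context torsion_free_module

\<comment> \<open>Ring and module structure of the localizations\<close>
begin

interpretation reg: torsion_free_module S "regular_module S" C
  by (rule regular)

lemma loc_ring_cases:
  assumes "A \<in> carrier (loc_ring S C)"
  obtains s c where "s \<in> carrier S" "c \<in> C" "A = rfrac S C s c"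
  using assms by (auto simp: loc_ring_simps reg.carrier_loc_module)

lemma rfrac_carrier [simp]: "s \<in> carrier S \<Longrightarrow> c \<in> C \<Longrightarrow> rfrac S C s c \<in> carrier (loc_ring S C)"
  by (auto simp: loc_ring_simps reg.carrier_loc_module)

lemma add_rfrac:
  assumes "s \<in> carrier S" "c \<in> C" "t \<in> carrier S" "d \<in> C"
  shows "rfrac S C s c \<oplus>\<^bsub>loc_ring S C\<^esub> rfrac S C t d = rfrac S C (d \<otimes> s \<oplus> c \<otimes> t) (c \<otimes> d)"
  using reg.add_frac assms by (simp add: loc_ring_simps)

lemma mult_rfrac:
  assumes "s \<in> carrier S" "c \<in> C" "t \<in> carrier S" "d \<in> C"
  shows "rfrac S C s c \<otimes>\<^bsub>loc_ring S C\<^esub> rfrac S C t d = rfrac S C (s \<otimes> t) (c \<otimes> d)"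
  using reg.smult_frac assms by (simp add: loc_ring_simps)

lemmas rfrac_eq_iff = reg.frac_eq_iff[simplified]

lemma cring_loc_ring: "cring (loc_ring S C)"
proof (rule cringI)
  interpret A: abelian_group "loc_module S (regular_module S) C"
    by (rule reg.abelian_group_loc_module)
  show "abelian_group (loc_ring S C)"
    by (rule abelian_groupI) (use A.l_neg in \<open>auto simp: loc_ring_simps A.a_ac\<close>)
  show "comm_monoid (loc_ring S C)"
    by (rule comm_monoidI)
      (auto elim!: loc_ring_cases simp: mult_rfrac loc_ring_simps(5) m_ac)
  show "(A \<oplus>\<^bsub>loc_ring S C\<^esub> B) \<otimes>\<^bsub>loc_ring S C\<^esub> E =
      A \<otimes>\<^bsub>loc_ring S C\<^esub> E \<oplus>\<^bsub>loc_ring S C\<^esub> B \<otimes>\<^bsub>loc_ring S C\<^esub> E"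
    if "A \<in> carrier (loc_ring S C)" "B \<in> carrier (loc_ring S C)" "E \<in> carrier (loc_ring S C)" for A B E
    using that
    by (elim loc_ring_cases) (simp add: mult_rfrac add_rfrac l_distr r_distr m_ac a_ac rfrac_eq_iff)
qed

lemma module_loc_module: "module (loc_ring S C) (loc_module S K C)"
proof (rule moduleI)
  show "(A \<oplus>\<^bsub>loc_ring S C\<^esub> B) \<odot>\<^bsub>loc_module S K C\<^esub> X =
      A \<odot>\<^bsub>loc_module S K C\<^esub> X \<oplus>\<^bsub>loc_module S K C\<^esub> B \<odot>\<^bsub>loc_module S K C\<^esub> X"
    if "A \<in> carrier (loc_ring S C)" "B \<in> carrier (loc_ring S C)" "X \<in> carrier (loc_module S K C)"
    for A B X
    using that
    by (elim loc_ring_cases loc_module_cases) (simp add: smult_frac add_rfrac add_frac smult_l_distr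
        smult_r_distr smult_assoc1 smult_left_commute m_ac M.a_ac frac_eq_iff)
  show "A \<odot>\<^bsub>loc_module S K C\<^esub> (X \<oplus>\<^bsub>loc_module S K C\<^esub> Y) =
      A \<odot>\<^bsub>loc_module S K C\<^esub> X \<oplus>\<^bsub>loc_module S K C\<^esub> A \<odot>\<^bsub>loc_module S K C\<^esub> Y"
    if "A \<in> carrier (loc_ring S C)" "X \<in> carrier (loc_module S K C)" "Y \<in> carrier (loc_module S K C)"
    for A X Y
    using that
    by (elim loc_ring_cases loc_module_cases) (simp add: smult_frac add_frac
        smult_r_distr smult_assoc1 smult_left_commute m_ac M.a_ac frac_eq_iff)
qed (auto elim!: loc_ring_cases loc_module_cases simp: cring_loc_ring abelian_group_loc_module
      smult_frac mult_rfrac smult_assoc1 m_assoc loc_ring_simps(5))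

section \<open>The canonical maps into the localizations\<close>

abbreviation "S\<^sub>C \<equiv> loc_ring S C"
abbreviation "K\<^sub>C \<equiv> loc_module S K C"
abbreviation "\<iota> \<equiv> loc_ring_incl S C"
abbreviation "\<kappa> \<equiv> loc_module_incl S K C"

lemma iota_closed [simp]: "s \<in> carrier S \<Longrightarrow> \<iota> s \<in> carrier S\<^sub>C"
  by (simp add: loc_ring_incl_def)

lemma kappa_closed [simp]: "x \<in> carrier K \<Longrightarrow> \<kappa> x \<in> carrier K\<^sub>C"
  by (simp add: loc_module_incl_def)

lemma iota_add:
  "s \<in> carrier S \<Longrightarrow> t \<in> carrier S \<Longrightarrow> \<iota> (s \<oplus> t) = \<iota> s \<oplus>\<^bsub>S\<^sub>C\<^esub> \<iota> t"
  by (simp add: loc_ring_incl_def add_rfrac)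

lemma iota_mult:
  "s \<in> carrier S \<Longrightarrow> t \<in> carrier S \<Longrightarrow> \<iota> (s \<otimes> t) = \<iota> s \<otimes>\<^bsub>S\<^sub>C\<^esub> \<iota> t"
  by (simp add: loc_ring_incl_def mult_rfrac)

lemma kappa_add:
  "x \<in> carrier K \<Longrightarrow> y \<in> carrier K \<Longrightarrow> \<kappa> (x \<oplus>\<^bsub>K\<^esub> y) = \<kappa> x \<oplus>\<^bsub>K\<^sub>C\<^esub> \<kappa> y"
  by (simp add: loc_module_incl_def add_frac)

lemma kappa_smult:
  "s \<in> carrier S \<Longrightarrow> x \<in> carrier K \<Longrightarrow> \<kappa> (s \<odot>\<^bsub>K\<^esub> x) = \<iota> s \<odot>\<^bsub>K\<^sub>C\<^esub> \<kappa> x"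
  by (simp add: loc_ring_incl_def loc_module_incl_def smult_frac)

lemma kappa_zero: "\<kappa> \<zero>\<^bsub>K\<^esub> = \<zero>\<^bsub>K\<^sub>C\<^esub>"
  by (simp add: loc_module_incl_def zero_loc_module)

lemma kappa_inject: "x \<in> carrier K \<Longrightarrow> y \<in> carrier K \<Longrightarrow> \<kappa> x = \<kappa> y \<longleftrightarrow> x = y"
  by (simp add: loc_module_incl_def frac_eq_iff)

text \<open>Elements of \<open>C\<close> still act injectively on \<open>K\<^sub>C\<close>: after
  cross-multiplication the factor \<open>c\<close> is cancelled in \<open>K\<close>.\<close>

lemma loc_cancel:
  assumes "c \<in> C" "X \<in> carrier K\<^sub>C" "Y \<in> carrier K\<^sub>C"
    and eq: "\<iota> c \<odot>\<^bsub>K\<^sub>C\<^esub> X = \<iota> c \<odot>\<^bsub>K\<^sub>C\<^esub> Y"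
  shows "X = Y"
proof -
  obtain x d y e where X: "x \<in> carrier K" "d \<in> C" "X = frac S K C x d"
    and Y: "y \<in> carrier K" "e \<in> C" "Y = frac S K C y e"
    using assms loc_module_cases by metis
  have "c \<odot>\<^bsub>K\<^esub> (e \<odot>\<^bsub>K\<^esub> x) = c \<odot>\<^bsub>K\<^esub> (d \<odot>\<^bsub>K\<^esub> y)"
    using eq X Y assms by (simp add: loc_ring_incl_def smult_frac frac_eq_iff smult_left_commute)
  then have "e \<odot>\<^bsub>K\<^esub> x = d \<odot>\<^bsub>K\<^esub> y"
    by (rule C_cancel[rotated 3]) (use X Y assms in auto)
  then show ?thesis
    using X Y by (simp add: frac_eq_iff)
qed

lemma denominator_ring:
  assumes "A \<in> carrier S\<^sub>C"
  obtains c s where "c \<in> C" "s \<in> carrier S" "\<iota> c \<otimes>\<^bsub>S\<^sub>C\<^esub> A = \<iota> s"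
proof -
  obtain s c where A: "s \<in> carrier S" "c \<in> C" "A = rfrac S C s c"
    using assms by (rule loc_ring_cases)
  then have "\<iota> c \<otimes>\<^bsub>S\<^sub>C\<^esub> A = \<iota> s"
    by (auto simp: loc_ring_incl_def mult_rfrac rfrac_eq_iff)
  then show thesis
    using that A by blast
qed

lemma denominator_module:
  assumes "X \<in> carrier K\<^sub>C"
  obtains c x where "c \<in> C" "x \<in> carrier K" "\<iota> c \<odot>\<^bsub>K\<^sub>C\<^esub> X = \<kappa> x"
proof -
  obtain x c where X: "x \<in> carrier K" "c \<in> C" "X = frac S K C x c"
    using assms by (rule loc_module_cases)
  then have "\<iota> c \<odot>\<^bsub>K\<^sub>C\<^esub> X = \<kappa> x"
    by (auto simp: loc_ring_incl_def loc_module_incl_def smult_frac frac_eq_iff)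
  then show thesis
    using that X by blast
qed

end

section \<open>Twisted subrings\<close>

locale twisted_subring = torsion_free_module S K C for S (structure) and K (structure) and C +
  fixes R D
  assumes R_subring: "subring R S"
    and D_twists: "twists S K C R D"
begin

interpretation loc: module S\<^sub>C K\<^sub>C
  by (rule module_loc_module)

text \<open>This is the second component of \<open>twist_map\<close>. Injectivity of
  \<open>\<kappa>\<close> makes the description definite on \<open>R\<close>; outside
  \<open>R\<close> the value is unspecified.\<close>

definition \<delta> where "\<delta> r = (THE k. k \<in> carrier K \<and> \<kappa> k = D (\<iota> r))"

lemma D_closed [simp]: "A \<in> carrier S\<^sub>C \<Longrightarrow> D A \<in> carrier K\<^sub>C"
  and D_add: "A \<in> carrier S\<^sub>C \<Longrightarrow> B \<in> carrier S\<^sub>C \<Longrightarrow> D (A \<oplus>\<^bsub>S\<^sub>C\<^esub> B) = D A \<oplus>\<^bsub>K\<^sub>C\<^esub> D B"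
  and D_mult: "A \<in> carrier S\<^sub>C \<Longrightarrow> B \<in> carrier S\<^sub>C \<Longrightarrow>
    D (A \<otimes>\<^bsub>S\<^sub>C\<^esub> B) = A \<odot>\<^bsub>K\<^sub>C\<^esub> D B \<oplus>\<^bsub>K\<^sub>C\<^esub> B \<odot>\<^bsub>K\<^sub>C\<^esub> D A"
  and D_C: "c \<in> C \<Longrightarrow> D (\<iota> c) = \<zero>\<^bsub>K\<^sub>C\<^esub>"
  and R_eq: "R = {s \<in> carrier S. D (\<iota> s) \<in> \<kappa> ` carrier K}"
  and D_generates: "gen_submodule S\<^sub>C K\<^sub>C (D ` carrier S\<^sub>C) = carrier K\<^sub>C"
  and D_kernel: "c \<in> C \<Longrightarrow> \<iota> ` carrier S \<subseteq> a_kernel S\<^sub>C K\<^sub>C D <+>\<^bsub>S\<^sub>C\<^esub> \<iota> ` (PIdl c)"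
  using D_twists unfolding twists_def derivation_def linear_over_def Let_def by auto

lemma D_C_mult:
  assumes "c \<in> C" "A \<in> carrier S\<^sub>C"
  shows "D (\<iota> c \<otimes>\<^bsub>S\<^sub>C\<^esub> A) = \<iota> c \<odot>\<^bsub>K\<^sub>C\<^esub> D A"
  using assms by (simp add: D_mult D_C)

text \<open>Condition (c) provides a kernel element \<open>B\<close> of \<open>S\<^sub>C\<close>
  only. As \<open>B\<close> differs from \<open>\<iota> s\<close> by an element of the image of
  \<open>S\<close>, it comes from \<open>S\<close> itself.\<close>

lemma kernel_decomposition:
  assumes "s \<in> carrier S" "c \<in> C"
  obtains b t where "b \<in> carrier S" "t \<in> carrier S" "D (\<iota> b) = \<zero>\<^bsub>K\<^sub>C\<^esub>" "s = b \<oplus> c \<otimes> t"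
proof -
  have "\<iota> s \<in> a_kernel S\<^sub>C K\<^sub>C D <+>\<^bsub>S\<^sub>C\<^esub> \<iota> ` (PIdl c)"
    using D_kernel[OF assms(2)] assms(1) by blast
  then obtain B T where "B \<in> a_kernel S\<^sub>C K\<^sub>C D" "T \<in> \<iota> ` (PIdl c)" "\<iota> s = B \<oplus>\<^bsub>S\<^sub>C\<^esub> T"
    unfolding set_add_def' by blast
  then obtain t where B: "B \<in> carrier S\<^sub>C" "D B = \<zero>\<^bsub>K\<^sub>C\<^esub>"
    and t: "t \<in> carrier S" "\<iota> s = B \<oplus>\<^bsub>S\<^sub>C\<^esub> \<iota> (t \<otimes> c)"
    unfolding a_kernel_def' cgenideal_def by blast
  have s: "s = (s \<ominus> c \<otimes> t) \<oplus> t \<otimes> c"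
    using assms t(1) C_carrier[OF assms(2)] by algebra
  then have "\<iota> (s \<ominus> c \<otimes> t) \<oplus>\<^bsub>S\<^sub>C\<^esub> \<iota> (t \<otimes> c) = B \<oplus>\<^bsub>S\<^sub>C\<^esub> \<iota> (t \<otimes> c)"
    using assms t by (metis C_carrier R.m_closed R.minus_closed iota_add)
  then have "\<iota> (s \<ominus> c \<otimes> t) = B"
    using assms t(1) B(1) by simp
  moreover have "s = (s \<ominus> c \<otimes> t) \<oplus> c \<otimes> t"
    using assms t(1) C_carrier[OF assms(2)] by algebra
  ultimately show thesis
    using that[of "s \<ominus> c \<otimes> t" t] assms t(1) B(2) by simp
qed

text \<open>This is the identity \<open>K\<^sub>C = D S + K\<close>. By condition (b) it suffices to
  place every multiple \<open>A D U\<close> of a derivative in \<open>D S + K\<close>.\<close>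

lemma loc_module_decomposition:
  assumes "X \<in> carrier K\<^sub>C"
  obtains s k where "s \<in> carrier S" "k \<in> carrier K" "X = D (\<iota> s) \<oplus>\<^bsub>K\<^sub>C\<^esub> \<kappa> k"
proof -
  define H where "H = {D (\<iota> s) \<oplus>\<^bsub>K\<^sub>C\<^esub> \<kappa> k | s k. s \<in> carrier S \<and> k \<in> carrier K}"
  \<comment> \<open>\<open>H\<close> is not visibly closed under scalars. \<open>H'\<close>, the set
    of elements all of whose multiples lie in \<open>H\<close>, is a submodule because
    \<open>H\<close> is closed under addition.\<close>
  define H' where "H' = {X \<in> carrier K\<^sub>C. \<forall>A\<in>carrier S\<^sub>C. A \<odot>\<^bsub>K\<^sub>C\<^esub> X \<in> H}"
  have H_mem: "D (\<iota> s) \<oplus>\<^bsub>K\<^sub>C\<^esub> \<kappa> k \<in> H" if "s \<in> carrier S" "k \<in> carrier K" for s k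
    unfolding H_def using that by blast
  have H_zero: "\<zero>\<^bsub>K\<^sub>C\<^esub> \<in> H"
    unfolding H_def using D_C[OF one_C] kappa_zero by (force intro!: exI[of _ \<one>] exI[of _ "\<zero>\<^bsub>K\<^esub>"])
  have H_add: "X \<oplus>\<^bsub>K\<^sub>C\<^esub> Y \<in> H" if XY: "X \<in> H" "Y \<in> H" for X Y
  proof -
    obtain s k where X: "s \<in> carrier S" "k \<in> carrier K" "X = D (\<iota> s) \<oplus>\<^bsub>K\<^sub>C\<^esub> \<kappa> k"
      using XY(1) unfolding H_def by blast
    obtain t l where Y: "t \<in> carrier S" "l \<in> carrier K" "Y = D (\<iota> t) \<oplus>\<^bsub>K\<^sub>C\<^esub> \<kappa> l"
      using XY(2) unfolding H_def by blast
    from X Y have "X \<oplus>\<^bsub>K\<^sub>C\<^esub> Y = D (\<iota> (s \<oplus> t)) \<oplus>\<^bsub>K\<^sub>C\<^esub> \<kappa> (k \<oplus>\<^bsub>K\<^esub> l)"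
      by (simp add: iota_add kappa_add D_add loc.M.a_ac)
    then show ?thesis
      using H_mem[of "s \<oplus> t" "k \<oplus>\<^bsub>K\<^esub> l"] X(1,2) Y(1,2) by simp
  qed
  have "A \<odot>\<^bsub>K\<^sub>C\<^esub> D U \<in> H" if A: "A \<in> carrier S\<^sub>C" and U: "U \<in> carrier S\<^sub>C" for A U
  proof -
    obtain d a where d: "d \<in> C" "a \<in> carrier S" "\<iota> d \<otimes>\<^bsub>S\<^sub>C\<^esub> A = \<iota> a"
      using A by (rule denominator_ring)
    obtain e s where e: "e \<in> C" "s \<in> carrier S" "\<iota> e \<otimes>\<^bsub>S\<^sub>C\<^esub> U = \<iota> s"
      using U by (rule denominator_ring)
    \<comment> \<open>\<open>f\<close> clears the denominator of
      \<open>D (\<iota> s)\<close>.\<close>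
    obtain f k where f: "f \<in> C" "k \<in> carrier K" "\<iota> f \<odot>\<^bsub>K\<^sub>C\<^esub> D (\<iota> s) = \<kappa> k"
      using e(2) by (auto intro: denominator_module[of "D (\<iota> s)"])
    \<comment> \<open>\<open>p\<close> clears the denominators of \<open>A\<close> and of
      \<open>U\<close> together, so that \<open>p A D U = a D s\<close>.\<close>
    define p where "p = d \<otimes> e"
    have p: "p \<in> C" "p \<otimes> f \<in> C"
      using d e f by (auto simp: p_def)
    \<comment> \<open>Splitting modulo \<open>p f\<close> serves two purposes:
      \<open>p f t D s\<close> is \<open>p\<close> times an element of \<open>K\<close>, and the
      remaining coefficient \<open>b\<close> is killed by \<open>D\<close>.\<close>
    obtain b t where b: "b \<in> carrier S" "t \<in> carrier S" "D (\<iota> b) = \<zero>\<^bsub>K\<^sub>C\<^esub>" "a = b \<oplus> (p \<otimes> f) \<otimes> t"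
      using d(2) p(2) by (rule kernel_decomposition)
    obtain b' t' where b': "b' \<in> carrier S" "t' \<in> carrier S" "D (\<iota> b') = \<zero>\<^bsub>K\<^sub>C\<^esub>" "b \<otimes> s = b' \<oplus> p \<otimes> t'"
      using b(1) e(2) p(1) by (auto intro: kernel_decomposition[of "b \<otimes> s" p])
    \<comment> \<open>Since \<open>D\<close> kills both \<open>b\<close> and \<open>b'\<close>, the
      Leibniz rule gives \<open>b D s = D (b s) = p D t'\<close>.\<close>
    have bs: "\<iota> b \<odot>\<^bsub>K\<^sub>C\<^esub> D (\<iota> s) = \<iota> p \<odot>\<^bsub>K\<^sub>C\<^esub> D (\<iota> t')"
    proof -
      have "\<iota> b \<odot>\<^bsub>K\<^sub>C\<^esub> D (\<iota> s) = D (\<iota> (b \<otimes> s))"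
        using b e by (simp add: iota_mult D_mult)
      also have "\<dots> = D (\<iota> p \<otimes>\<^bsub>S\<^sub>C\<^esub> \<iota> t')"
        using b' p by (simp add: iota_add iota_mult D_add)
      also have "\<dots> = \<iota> p \<odot>\<^bsub>K\<^sub>C\<^esub> D (\<iota> t')"
        using p b' by (simp add: D_C_mult)
      finally show ?thesis .
    qed
    have "\<iota> p \<odot>\<^bsub>K\<^sub>C\<^esub> (A \<odot>\<^bsub>K\<^sub>C\<^esub> D U) = (\<iota> d \<otimes>\<^bsub>S\<^sub>C\<^esub> A) \<odot>\<^bsub>K\<^sub>C\<^esub> (\<iota> e \<odot>\<^bsub>K\<^sub>C\<^esub> D U)"
      using d(1) e(1) A U by (simp add: p_def iota_mult loc.smult_assoc1 loc.smult_left_commute)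
    also have "\<iota> e \<odot>\<^bsub>K\<^sub>C\<^esub> D U = D (\<iota> s)"
      using e U D_C_mult by metis
    also have "(\<iota> d \<otimes>\<^bsub>S\<^sub>C\<^esub> A) \<odot>\<^bsub>K\<^sub>C\<^esub> D (\<iota> s) =
        \<iota> b \<odot>\<^bsub>K\<^sub>C\<^esub> D (\<iota> s) \<oplus>\<^bsub>K\<^sub>C\<^esub> \<iota> p \<odot>\<^bsub>K\<^sub>C\<^esub> (\<iota> t \<odot>\<^bsub>K\<^sub>C\<^esub> (\<iota> f \<odot>\<^bsub>K\<^sub>C\<^esub> D (\<iota> s)))"
      using d(3) b(1,2,4) p(1) f(1) e(2)
      by (simp add: iota_mult iota_add loc.smult_l_distr loc.smult_assoc1 loc.smult_left_commute)
    also have "\<dots> = \<iota> p \<odot>\<^bsub>K\<^sub>C\<^esub> (D (\<iota> t') \<oplus>\<^bsub>K\<^sub>C\<^esub> \<kappa> (t \<odot>\<^bsub>K\<^esub> k))"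
      using b(2) b'(2) f(2,3) p(1) by (simp add: bs kappa_smult loc.smult_r_distr)
    \<comment> \<open>Both sides now carry the factor \<open>p\<close>, which is cancelled in
      \<open>K\<^sub>C\<close>.\<close>
    finally have "A \<odot>\<^bsub>K\<^sub>C\<^esub> D U = D (\<iota> t') \<oplus>\<^bsub>K\<^sub>C\<^esub> \<kappa> (t \<odot>\<^bsub>K\<^esub> k)"
      by (rule loc_cancel[rotated 3]) (use A U p(1) b(2) b'(2) f(2) in auto)
    then show ?thesis
      using H_mem[of t' "t \<odot>\<^bsub>K\<^esub> k"] b(2) b'(2) f(2) by simp
  qed
  then have "D ` carrier S\<^sub>C \<subseteq> H'"
    by (auto simp: H'_def)
  moreover have "submodule H' S\<^sub>C K\<^sub>C"
  proof (rule loc.submoduleI)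
    show "\<ominus>\<^bsub>K\<^sub>C\<^esub> X \<in> H'" if "X \<in> H'" for X
      unfolding H'_def
    proof (safe)
      show "\<ominus>\<^bsub>K\<^sub>C\<^esub> X \<in> carrier K\<^sub>C"
        using that by (simp add: H'_def)
      show "A \<odot>\<^bsub>K\<^sub>C\<^esub> (\<ominus>\<^bsub>K\<^sub>C\<^esub> X) \<in> H" if "A \<in> carrier S\<^sub>C" for A
      proof -
        have "A \<odot>\<^bsub>K\<^sub>C\<^esub> (\<ominus>\<^bsub>K\<^sub>C\<^esub> X) = (\<ominus>\<^bsub>S\<^sub>C\<^esub> A) \<odot>\<^bsub>K\<^sub>C\<^esub> X"
          using that \<open>X \<in> H'\<close> by (simp add: H'_def loc.smult_l_minus loc.smult_r_minus)
        then show ?thesis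
          using that \<open>X \<in> H'\<close> by (simp add: H'_def)
      qed
    qed
  qed (auto simp: H'_def H_zero H_add loc.smult_r_distr loc.smult_assoc1[symmetric])
  ultimately have "carrier K\<^sub>C \<subseteq> H'"
    using D_generates unfolding gen_submodule_def by (metis hull_minimal)
  then have "\<forall>A\<in>carrier S\<^sub>C. A \<odot>\<^bsub>K\<^sub>C\<^esub> X \<in> H"
    using assms unfolding H'_def by blast
  then have "\<one>\<^bsub>S\<^sub>C\<^esub> \<odot>\<^bsub>K\<^sub>C\<^esub> X \<in> H"
    by blast
  then have "X \<in> H"
    using assms by simp
  then show thesis
    using that unfolding H_def by blast
qed

section \<open>The restricted derivation from \<open>R\<close> to \<open>K\<close>\<close>

lemma R_carrier [simp]: "r \<in> R \<Longrightarrow> r \<in> carrier S"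
  using R_eq by blast

text \<open>By injectivity of \<open>\<kappa>\<close>, one equation in \<open>K\<^sub>C\<close>
  yields both membership in \<open>R\<close> and the value of \<open>\<delta>\<close>; the rules for
  sums and products are obtained from it.\<close>

lemma mem_RI:
  assumes "s \<in> carrier S" "k \<in> carrier K" "D (\<iota> s) = \<kappa> k"
  shows "s \<in> R" "\<delta> s = k"
proof -
  have "D (\<iota> s) \<in> \<kappa> ` carrier K"
    using assms by simp
  then show "s \<in> R"
    using assms(1) R_eq by blast
  show "\<delta> s = k"
    unfolding \<delta>_def by (rule the_equality) (auto simp: assms kappa_inject)
qed

lemma
  assumes "r \<in> R"
  shows delta_closed [simp]: "\<delta> r \<in> carrier K"
    and kappa_delta: "\<kappa> (\<delta> r) = D (\<iota> r)"
proof -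
  obtain k where "k \<in> carrier K" "D (\<iota> r) = \<kappa> k"
    using assms R_eq by blast
  then show "\<delta> r \<in> carrier K" "\<kappa> (\<delta> r) = D (\<iota> r)"
    using mem_RI(2)[of r k] assms by simp_all
qed

lemma delta_add:
  assumes "r \<in> R" "s \<in> R"
  shows "\<delta> (r \<oplus> s) = \<delta> r \<oplus>\<^bsub>K\<^esub> \<delta> s"
  using assms by (intro mem_RI) (simp_all add: kappa_add kappa_delta iota_add D_add)

lemma delta_mult:
  assumes "r \<in> R" "s \<in> R"
  shows "\<delta> (r \<otimes> s) = r \<odot>\<^bsub>K\<^esub> \<delta> s \<oplus>\<^bsub>K\<^esub> s \<odot>\<^bsub>K\<^esub> \<delta> r"
  using assms by (intro mem_RI) (simp_all add: kappa_add kappa_smult kappa_delta iota_mult D_mult)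

lemma C_R [simp]: "c \<in> C \<Longrightarrow> c \<in> R"
  and delta_C: "c \<in> C \<Longrightarrow> \<delta> c = \<zero>\<^bsub>K\<^esub>"
  using mem_RI[of c "\<zero>\<^bsub>K\<^esub>"] by (simp_all add: D_C kappa_zero)

text \<open>This gives injectivity of
  \<open>R / c R \<rightarrow> (S \<star> K) / c (S \<star> K)\<close>: by
  \<open>C\<close>-linearity \<open>D (c s) = c D s\<close>, and \<open>c\<close> cancels in
  \<open>K\<^sub>C\<close>.\<close>

lemma divide_C:
  assumes "c \<in> C" "s \<in> carrier S" "k \<in> carrier K" "c \<otimes> s \<in> R" "\<delta> (c \<otimes> s) = c \<odot>\<^bsub>K\<^esub> k"
  shows "s \<in> R" "\<delta> s = k"
proof -
  have "\<iota> c \<odot>\<^bsub>K\<^sub>C\<^esub> D (\<iota> s) = \<iota> c \<odot>\<^bsub>K\<^sub>C\<^esub> \<kappa> k"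
    using assms kappa_delta[OF assms(4)] by (simp add: iota_mult kappa_smult D_C_mult)
  then have "D (\<iota> s) = \<kappa> k"
    by (rule loc_cancel[rotated 3]) (use assms in auto)
  then show "s \<in> R" "\<delta> s = k"
    using assms mem_RI by auto
qed

text \<open>This is surjectivity of
  \<open>R / c R \<rightarrow> (S \<star> K) / c (S \<star> K)\<close>. The first component is
  settled by condition (c), the second by decomposing the fraction \<open>k / c\<close>.\<close>

lemma dense:
  assumes "c \<in> C" "s \<in> carrier S" "k \<in> carrier K"
  obtains r t l where "r \<in> R" "t \<in> carrier S" "l \<in> carrier K"
    "s = r \<oplus> c \<otimes> t" "k = \<delta> r \<oplus>\<^bsub>K\<^esub> c \<odot>\<^bsub>K\<^esub> l"
proof -
  obtain b t where b: "b \<in> carrier S" "t \<in> carrier S" "D (\<iota> b) = \<zero>\<^bsub>K\<^sub>C\<^esub>" "s = b \<oplus> c \<otimes> t"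
    using assms(2,1) by (rule kernel_decomposition)
  \<comment> \<open>If \<open>k / c = D u + l\<close>, then \<open>k - c l = D (c u)\<close>. Adding
    \<open>c u\<close> to the kernel element \<open>b\<close> therefore adjusts the derivative
    without changing the class modulo \<open>c\<close>.\<close>
  define X where "X = frac S K C k c"
  have X: "X \<in> carrier K\<^sub>C" "\<iota> c \<odot>\<^bsub>K\<^sub>C\<^esub> X = \<kappa> k"
    using assms by (auto simp: X_def loc_ring_incl_def loc_module_incl_def smult_frac frac_eq_iff)
  obtain u l where u: "u \<in> carrier S" "l \<in> carrier K" "X = D (\<iota> u) \<oplus>\<^bsub>K\<^sub>C\<^esub> \<kappa> l"
    using X(1) by (rule loc_module_decomposition)
  define k' where "k' = k \<ominus>\<^bsub>K\<^esub> c \<odot>\<^bsub>K\<^esub> l"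
  have k': "k' \<in> carrier K" "k = k' \<oplus>\<^bsub>K\<^esub> c \<odot>\<^bsub>K\<^esub> l"
    using assms u by (auto simp: k'_def M.minus_eq M.a_assoc M.l_neg)
  have "D (\<iota> (b \<oplus> c \<otimes> u)) \<oplus>\<^bsub>K\<^sub>C\<^esub> \<kappa> (c \<odot>\<^bsub>K\<^esub> l) = \<iota> c \<odot>\<^bsub>K\<^sub>C\<^esub> X"
    using b u assms by (simp add: iota_add iota_mult D_add D_C_mult kappa_smult loc.smult_r_distr)
  also have "\<dots> = \<kappa> k' \<oplus>\<^bsub>K\<^sub>C\<^esub> \<kappa> (c \<odot>\<^bsub>K\<^esub> l)"
    using X k' u(2) assms(1) by (simp add: kappa_add)
  finally have D: "D (\<iota> (b \<oplus> c \<otimes> u)) = \<kappa> k'"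
    using b(1) u(1,2) k'(1) assms(1) by simp
  have s: "s = (b \<oplus> c \<otimes> u) \<oplus> c \<otimes> (t \<ominus> u)"
    unfolding b(4) using b(1,2) u(1) C_carrier[OF assms(1)] by algebra
  show thesis
    using that[OF _ _ _ s, of l] mem_RI[OF _ k'(1) D] b(1,2) u(1,2) k'(2) assms(1) by simp
qed

end

section \<open>Powers of ideals\<close>

lemma ideal_power_0 [simp]: "ideal_power A I 0 = carrier A"
  by (simp add: ideal_power_def nat_pow_def ideals_set_def)

lemma ideal_power_Suc: "ideal_power A I (Suc n) = ideal_prod A (ideal_power A I n) I"
  by (simp add: ideal_power_def nat_pow_def ideals_set_def)

lemma (in ring) ideal_ideal_power: "ideal I R \<Longrightarrow> ideal (ideal_power R I n) R"
  by (induction n) (simp_all add: oneideal ideal_power_Suc ideal_prod_is_ideal)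

lemma (in ring) ideal_power_antimono: "ideal I R \<Longrightarrow> ideal_power R I (Suc n) \<subseteq> ideal_power R I n"
  using ideal_prod_inter[OF ideal_ideal_power[of I n]] by (auto simp: ideal_power_Suc)

lemma ideal_power_SucI:
  "a \<in> ideal_power A I n \<Longrightarrow> b \<in> I \<Longrightarrow> a \<otimes>\<^bsub>A\<^esub> b \<in> ideal_power A I (Suc n)"
  by (simp add: ideal_power_Suc ideal_prod.prod)

text \<open>An element of a power is a finite sum of products with last factor in \<open>I\<close>;
  the claims on powers below are thereby reduced to products and sums.\<close>

lemma ideal_power_Suc_induct [consumes 1, case_names prod sum]:
  assumes "a \<in> ideal_power A I (Suc n)"
    and "\<And>b e. b \<in> ideal_power A I n \<Longrightarrow> e \<in> I \<Longrightarrow> P (b \<otimes>\<^bsub>A\<^esub> e)"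
    and "\<And>a b. a \<in> ideal_power A I (Suc n) \<Longrightarrow> P a \<Longrightarrow> b \<in> ideal_power A I (Suc n) \<Longrightarrow> P b \<Longrightarrow>
      P (a \<oplus>\<^bsub>A\<^esub> b)"
  shows "P a"
  using assms unfolding ideal_power_Suc by (rule ideal_prod.induct)

lemma (in module) submodule_zero: "submodule H R M \<Longrightarrow> \<zero>\<^bsub>M\<^esub> \<in> H"
  using subgroup.one_closed[OF submodule.axioms(1)] by fastforce

lemma (in module) submodule_gen_submodule:
  assumes "X \<subseteq> carrier M"
  shows "submodule (gen_submodule R M X) R M"
proof (rule submoduleI)
  show "gen_submodule R M X \<subseteq> carrier M"
    unfolding gen_submodule_def by (rule hull_minimal[OF assms]) (rule submoduleI; simp)
qed (auto simp: gen_submodule_def hull_def dest: submoduleE submodule_zero)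

lemma (in module) ideal_power_module_submodule:
  assumes "ideal I R"
  shows "submodule (ideal_power_module R M I n) R M"
  unfolding ideal_power_module_def
  using ideal.Icarr[OF ideal_ideal_power[OF assms]] by (intro submodule_gen_submodule) auto

lemma (in module) smult_ideal_power_module:
  assumes "a \<in> ideal_power R I n" "x \<in> carrier M"
  shows "a \<odot>\<^bsub>M\<^esub> x \<in> ideal_power_module R M I n"
  unfolding ideal_power_module_def gen_submodule_def
  by (rule subsetD[OF hull_subset]) (use assms in blast)

lemma (in module) ideal_power_module_minimal:
  assumes "submodule H R M" "\<And>a x. a \<in> ideal_power R I n \<Longrightarrow> x \<in> carrier M \<Longrightarrow> a \<odot>\<^bsub>M\<^esub> x \<in> H"
  shows "ideal_power_module R M I n \<subseteq> H"
  unfolding ideal_power_module_def gen_submodule_def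
  by (rule hull_minimal) (use assms in auto)

lemma (in module) ideal_power_module_antimono:
  assumes "ideal I R"
  shows "ideal_power_module R M I (Suc n) \<subseteq> ideal_power_module R M I n"
  using assms ideal_power_antimono[OF assms, of n]
  by (intro ideal_power_module_minimal ideal_power_module_submodule smult_ideal_power_module) auto

text \<open>The elements that \<open>b\<close> sends into \<open>I\<^sup>n\<^sup>+\<^sup>1 M\<close>
  form a submodule containing the generators of \<open>I\<^sup>n M\<close>.\<close>

lemma (in module) smult_ideal_power_module_Suc:
  assumes "ideal I R" "b \<in> I" "x \<in> ideal_power_module R M I n"
  shows "b \<odot>\<^bsub>M\<^esub> x \<in> ideal_power_module R M I (Suc n)"
proof -
  define H where "H = {x \<in> carrier M. b \<odot>\<^bsub>M\<^esub> x \<in> ideal_power_module R M I (Suc n)}"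
  note sub = submoduleE[OF ideal_power_module_submodule[OF assms(1), of "Suc n"]]
  have b: "b \<in> carrier R"
    using assms ideal.Icarr by fastforce
  have zero: "\<zero>\<^bsub>M\<^esub> \<in> ideal_power_module R M I (Suc n)"
    using assms(1) by (intro submodule_zero ideal_power_module_submodule)
  have "submodule H R M"
    by (rule submoduleI)
      (use b sub zero in \<open>auto simp: H_def smult_r_minus smult_r_distr smult_left_commute[of b]\<close>)
  moreover have "a \<odot>\<^bsub>M\<^esub> y \<in> H" if "a \<in> ideal_power R I n" "y \<in> carrier M" for a y
  proof -
    have a: "a \<in> carrier R"
      using that ideal.Icarr[OF ideal_ideal_power[OF assms(1)]] by blast
    have "(a \<otimes> b) \<odot>\<^bsub>M\<^esub> y \<in> ideal_power_module R M I (Suc n)"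
      using that assms by (intro smult_ideal_power_module ideal_power_SucI)
    then show ?thesis
      using a b that by (simp add: H_def smult_assoc1 smult_left_commute[of b])
  qed
  ultimately show ?thesis
    using ideal_power_module_minimal[of H I n] assms(3) by (auto simp: H_def)
qed

section \<open>Comparison of the adic filtrations\<close>

locale adic_twisted_subring = twisted_subring S K C R D
  for S (structure) and K (structure) and C R D +
  fixes M c
  assumes M_ideal: "ideal M S"
    and c_C: "c \<in> C"
    and c_M: "c \<in> M"
begin

text \<open>The candidate for the maximal ideal of \<open>R\<close>; \<open>m_maximal\<close>
  confirms it.\<close>

definition "m = M \<inter> R"

abbreviation "R' \<equiv> S\<lparr>carrier := R\<rparr>"
abbreviation "M_pow n \<equiv> ideal_power S M n"
abbreviation "m_pow n \<equiv> ideal_power R' m n"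
abbreviation "N n \<equiv> ideal_power_module S K M n"

sublocale R': cring R'
  using subcring_iff[OF subringE(1)[OF R_subring]] subcringI'[OF R_subring] by simp

lemmas R_closed [simp] = subringE(2,3,5-7)[OF R_subring]

lemma a_inv_R' [simp]: "r \<in> R \<Longrightarrow> \<ominus>\<^bsub>R'\<^esub> r = \<ominus> r"
  by (rule R'.minus_equality) (auto simp: R.l_neg)

lemma m_ideal: "ideal m R'"
proof -
  interpret I: ideal M S
    by (rule M_ideal)
  have ne: "M \<inter> R \<noteq> {}"
    using I.zero_closed R_closed(1) by blast
  show ?thesis
  proof (rule idealI)
    show "subgroup m (add_monoid R')"
      by (rule R'.add.subgroupI) (use ne in \<open>auto simp: m_def\<close>)
  qed (auto simp: m_def R'.ring_axioms I.I_l_closed I.I_r_closed)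
qed

lemma c_m: "c \<in> m"
  using c_C c_M by (simp add: m_def)

lemma m_pow_R: "r \<in> m_pow n \<Longrightarrow> r \<in> R"
  using ideal.Icarr[OF R'.ideal_ideal_power[OF m_ideal]] by force

lemma M_pow_S: "s \<in> M_pow n \<Longrightarrow> s \<in> carrier S"
  using ideal.Icarr[OF ideal_ideal_power[OF M_ideal]] by force

lemma N_K: "k \<in> N n \<Longrightarrow> k \<in> carrier K"
  using submoduleE(1)[OF ideal_power_module_submodule[OF M_ideal]] by blast

lemma c_pow_m_pow: "c [^] n \<in> m_pow n"
proof (induction n)
  case (Suc n)
  then show ?case
    using ideal_power_SucI[OF Suc c_m] by simp
qed simp

lemma m_pow_M_pow: "r \<in> m_pow n \<Longrightarrow> r \<in> M_pow n"
proof (induction n arbitrary: r)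
  case (Suc n)
  from Suc.prems show ?case
  proof (induction rule: ideal_power_Suc_induct)
    case (prod b e)
    then show ?case
      using ideal_power_SucI[OF Suc.IH, of b e] by (simp add: m_def)
  next
    case (sum a b)
    then show ?case
      using additive_subgroup.a_closed[OF ideal.axioms(1)[OF ideal_ideal_power[OF M_ideal]]] by simp
  qed
qed simp

lemma N_add: "x \<in> N n \<Longrightarrow> y \<in> N n \<Longrightarrow> x \<oplus>\<^bsub>K\<^esub> y \<in> N n"
  and N_smult: "s \<in> carrier S \<Longrightarrow> x \<in> N n \<Longrightarrow> s \<odot>\<^bsub>K\<^esub> x \<in> N n"
  and N_minus: "x \<in> N n \<Longrightarrow> \<ominus>\<^bsub>K\<^esub> x \<in> N n"
  using submoduleE[OF ideal_power_module_submodule[OF M_ideal]] by blast+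

lemma N_0 [simp]: "N 0 = carrier K"
  using smult_ideal_power_module[of \<one> M 0] N_K by force

text \<open>In \<open>\<delta> (b e) = b \<delta> e + e \<delta> b\<close> the first term keeps
  \<open>b\<close> whole, and in the second \<open>e\<close> restores the power that
  \<open>\<delta> b\<close> lacks. Altogether one power is lost.\<close>

lemma delta_m_pow: "r \<in> m_pow (Suc n) \<Longrightarrow> \<delta> r \<in> N n"
proof (induction n arbitrary: r)
  case 0
  then show ?case
    using m_pow_R by simp
next
  case (Suc n)
  from Suc.prems show ?case
  proof (induction rule: ideal_power_Suc_induct)
    case (prod b e)
    then have R: "b \<in> R" "e \<in> R" "e \<in> M"
      using m_pow_R by (auto simp: m_def)
    have "b \<odot>\<^bsub>K\<^esub> \<delta> e \<in> N (Suc n)"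
      using prod R m_pow_M_pow by (intro smult_ideal_power_module) auto
    moreover have "e \<odot>\<^bsub>K\<^esub> \<delta> b \<in> N (Suc n)"
      using prod R Suc.IH by (intro smult_ideal_power_module_Suc[OF M_ideal]) auto
    ultimately show ?case
      using R by (simp add: delta_mult N_add)
  next
    case (sum a b)
    then show ?case
      using m_pow_R by (simp add: delta_add N_add)
  qed
qed

text \<open>\<open>F n\<close> is the extension of \<open>m\<^sup>n\<close> along \<open>r \<mapsto> (r, \<delta> r)\<close> to an ideal of \<open>S \<star> K\<close>; it takes this
  form because \<open>c\<^sup>n \<in> m\<^sup>n\<close> and every element of \<open>S \<star> K\<close> is congruent to one of \<open>R\<close> modulo \<open>c\<^sup>n\<close>.\<close>

definition "F n s k \<longleftrightarrow> (\<exists>a\<in>m_pow n. \<exists>v\<in>carrier S. \<exists>w\<in>carrier K.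
  s = a \<oplus> c [^] n \<otimes> v \<and> k = \<delta> a \<oplus>\<^bsub>K\<^esub> c [^] n \<odot>\<^bsub>K\<^esub> w)"

lemma FE:
  assumes "F n s k"
  obtains a v w where "a \<in> m_pow n" "a \<in> R" "v \<in> carrier S" "w \<in> carrier K"
    "s = a \<oplus> c [^] n \<otimes> v" "k = \<delta> a \<oplus>\<^bsub>K\<^esub> c [^] n \<odot>\<^bsub>K\<^esub> w"
  using assms m_pow_R unfolding F_def by blast

lemma c_pow [simp]: "c [^] (n::nat) \<in> C" "c [^] (n::nat) \<in> carrier S"
  using c_C by simp_all

lemma c_S [simp]: "c \<in> carrier S"
  using c_C by simp

lemmas mac = smult_l_distr smult_r_distr smult_assoc1 smult_left_commute M.a_ac
lemmas rac = l_distr r_distr m_ac R.a_ac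

lemma F_add:
  assumes "F n s k" "F n t l"
  shows "F n (s \<oplus> t) (k \<oplus>\<^bsub>K\<^esub> l)"
proof -
  obtain a v w where 1: "a \<in> m_pow n" "a \<in> R" "v \<in> carrier S" "w \<in> carrier K"
    "s = a \<oplus> c [^] n \<otimes> v" "k = \<delta> a \<oplus>\<^bsub>K\<^esub> c [^] n \<odot>\<^bsub>K\<^esub> w"
    using assms(1) by (rule FE)
  obtain b x y where 2: "b \<in> m_pow n" "b \<in> R" "x \<in> carrier S" "y \<in> carrier K"
    "t = b \<oplus> c [^] n \<otimes> x" "l = \<delta> b \<oplus>\<^bsub>K\<^esub> c [^] n \<odot>\<^bsub>K\<^esub> y"
    using assms(2) by (rule FE)
  have "a \<oplus> b \<in> m_pow n"
    using additive_subgroup.a_closed[OF ideal.axioms(1)[OF R'.ideal_ideal_power[OF m_ideal]] 1(1) 2(1)]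
    by simp
  moreover have "s \<oplus> t = (a \<oplus> b) \<oplus> c [^] n \<otimes> (v \<oplus> x)"
    using 1 2 by (simp add: rac)
  moreover have "k \<oplus>\<^bsub>K\<^esub> l = \<delta> (a \<oplus> b) \<oplus>\<^bsub>K\<^esub> c [^] n \<odot>\<^bsub>K\<^esub> (w \<oplus>\<^bsub>K\<^esub> y)"
    using 1 2 by (simp add: delta_add mac)
  ultimately show ?thesis
    unfolding F_def using 1(3,4) 2(3,4) by (metis R.a_closed M.a_closed)
qed

text \<open>\<open>dense\<close> splits the multiplier \<open>(u, l)\<close> as
  \<open>f r + c\<^sup>n (x, y)\<close>. Only \<open>r a\<close> has to lie in
  \<open>m\<^sup>n\<close>; all other terms are multiples of \<open>c\<^sup>n\<close>.\<close>

lemma F_mult: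
  assumes "F n s k" "u \<in> carrier S" "l \<in> carrier K"
  shows "F n (u \<otimes> s) (u \<odot>\<^bsub>K\<^esub> k \<oplus>\<^bsub>K\<^esub> s \<odot>\<^bsub>K\<^esub> l)"
proof -
  obtain a v w where 1: "a \<in> m_pow n" "a \<in> R" "v \<in> carrier S" "w \<in> carrier K"
    "s = a \<oplus> c [^] n \<otimes> v" "k = \<delta> a \<oplus>\<^bsub>K\<^esub> c [^] n \<odot>\<^bsub>K\<^esub> w"
    using assms(1) by (rule FE)
  obtain r x y where 2: "r \<in> R" "x \<in> carrier S" "y \<in> carrier K"
    "u = r \<oplus> c [^] n \<otimes> x" "l = \<delta> r \<oplus>\<^bsub>K\<^esub> c [^] n \<odot>\<^bsub>K\<^esub> y"
    using assms(2,3) by (auto intro: dense[of "c [^] n" u l])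
  have "r \<otimes> a \<in> m_pow n"
    using ideal.I_l_closed[OF R'.ideal_ideal_power[OF m_ideal] 1(1)] 2(1) by simp
  moreover have "u \<otimes> s = r \<otimes> a \<oplus> c [^] n \<otimes> (x \<otimes> s \<oplus> r \<otimes> v)"
    using 1 2 by (simp add: rac)
  moreover have "u \<odot>\<^bsub>K\<^esub> k \<oplus>\<^bsub>K\<^esub> s \<odot>\<^bsub>K\<^esub> l = \<delta> (r \<otimes> a) \<oplus>\<^bsub>K\<^esub>
      c [^] n \<odot>\<^bsub>K\<^esub> (r \<odot>\<^bsub>K\<^esub> w \<oplus>\<^bsub>K\<^esub> x \<odot>\<^bsub>K\<^esub> k \<oplus>\<^bsub>K\<^esub> v \<odot>\<^bsub>K\<^esub> \<delta> r \<oplus>\<^bsub>K\<^esub> s \<odot>\<^bsub>K\<^esub> y)"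
    using 1 2 by (simp add: delta_mult mac)
  moreover have "s \<in> carrier S" "k \<in> carrier K"
    using 1 by auto
  ultimately show ?thesis
    unfolding F_def using 1(2-4) 2(1-3)
    by (intro bexI[of _ "r \<otimes> a"] bexI[of _ "x \<otimes> s \<oplus> r \<otimes> v"]
        bexI[of _ "r \<odot>\<^bsub>K\<^esub> w \<oplus>\<^bsub>K\<^esub> x \<odot>\<^bsub>K\<^esub> k \<oplus>\<^bsub>K\<^esub> v \<odot>\<^bsub>K\<^esub> \<delta> r \<oplus>\<^bsub>K\<^esub> s \<odot>\<^bsub>K\<^esub> y"]) simp_all
qed

text \<open>Multiplication by \<open>f r\<close> with \<open>r\<close> in \<open>m\<close> raises
  the level by one. The remainder \<open>c\<^sup>n (v, w)\<close> gains no factor \<open>c\<close>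
  from it, so \<open>(v, w)\<close> is first split modulo \<open>c\<close> into \<open>f r'\<close>
  and a multiple of \<open>c\<close>.\<close>

lemma F_Suc:
  assumes "F n s k" "r \<in> m"
  shows "F (Suc n) (r \<otimes> s) (r \<odot>\<^bsub>K\<^esub> k \<oplus>\<^bsub>K\<^esub> s \<odot>\<^bsub>K\<^esub> \<delta> r)"
proof -
  obtain a v w where 1: "a \<in> m_pow n" "a \<in> R" "v \<in> carrier S" "w \<in> carrier K"
    "s = a \<oplus> c [^] n \<otimes> v" "k = \<delta> a \<oplus>\<^bsub>K\<^esub> c [^] n \<odot>\<^bsub>K\<^esub> w"
    using assms(1) by (rule FE)
  obtain r' x y where 2: "r' \<in> R" "x \<in> carrier S" "y \<in> carrier K"
    "v = r' \<oplus> c \<otimes> x" "w = \<delta> r' \<oplus>\<^bsub>K\<^esub> c \<odot>\<^bsub>K\<^esub> y"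
    using 1(3,4) c_C by (auto intro: dense[of c v w])
  have r: "r \<in> R" "r \<in> carrier S"
    using assms(2) by (auto simp: m_def)
  \<comment> \<open>\<open>b\<close> collects the contributions from \<open>R\<close>; the second
    one lies in \<open>m\<^sup>n\<^sup>+\<^sup>1\<close> because \<open>r r'\<close> is in
    \<open>m\<close>.\<close>
  define b where "b = a \<otimes> r \<oplus> c [^] n \<otimes> (r \<otimes> r')"
  have "a \<otimes> r \<in> m_pow (Suc n)"
    using ideal_power_SucI[OF 1(1) assms(2)] by simp
  moreover have "r \<otimes> r' \<in> m"
    using ideal.I_r_closed[OF m_ideal assms(2)] 2(1) by simp
  then have "c [^] n \<otimes> (r \<otimes> r') \<in> m_pow (Suc n)"
    using ideal_power_SucI[OF c_pow_m_pow] by fastforce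
  ultimately have "b \<in> m_pow (Suc n)"
    using additive_subgroup.a_closed[OF ideal.axioms(1)[OF R'.ideal_ideal_power[OF m_ideal]]]
    by (fastforce simp: b_def)
  moreover have "r \<otimes> s = b \<oplus> c [^] Suc n \<otimes> (r \<otimes> x)"
    unfolding 1(5) 2(4) b_def using 1(2) 2(1,2) r by (simp add: rac)
  moreover have "r \<odot>\<^bsub>K\<^esub> k \<oplus>\<^bsub>K\<^esub> s \<odot>\<^bsub>K\<^esub> \<delta> r = \<delta> b \<oplus>\<^bsub>K\<^esub>
      c [^] Suc n \<odot>\<^bsub>K\<^esub> (x \<odot>\<^bsub>K\<^esub> \<delta> r \<oplus>\<^bsub>K\<^esub> r \<odot>\<^bsub>K\<^esub> y)"
    unfolding 1(5,6) 2(4,5) b_def using 1(2) 2(1-3) r by (simp add: delta_add delta_mult delta_C mac)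
  ultimately show ?thesis
    unfolding F_def using 2(2,3) r
    by (intro bexI[of _ b] bexI[of _ "r \<otimes> x"] bexI[of _ "x \<odot>\<^bsub>K\<^esub> \<delta> r \<oplus>\<^bsub>K\<^esub> r \<odot>\<^bsub>K\<^esub> y"]) simp_all
qed

text \<open>The case \<open>r = c\<close> of \<open>F_Suc\<close>, where the derivative term
  vanishes.\<close>

lemma F_c:
  assumes "F n s k" "s \<in> carrier S" "k \<in> carrier K"
  shows "F (Suc n) (c \<otimes> s) (c \<odot>\<^bsub>K\<^esub> k)"
  using F_Suc[OF assms(1) c_m] assms c_C by (simp add: delta_C)

lemma delta_zero [simp]: "\<delta> \<zero> = \<zero>\<^bsub>K\<^esub>"
  using delta_add[of \<zero> \<zero>] by (metis R_closed(1) M.add.r_cancel_one' delta_closed R.r_zero R.zero_closed)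

lemma F_0:
  assumes "s \<in> carrier S" "k \<in> carrier K"
  shows "F 0 s k"
  unfolding F_def using assms
  by (intro bexI[of _ \<zero>] bexI[of _ s] bexI[of _ k]) simp_all

lemma F_zero: "F n \<zero> \<zero>\<^bsub>K\<^esub>"
  unfolding F_def using additive_subgroup.zero_closed[OF ideal.axioms(1)[OF R'.ideal_ideal_power[OF m_ideal]]]
  by (intro bexI[of _ \<zero>] bexI[of _ "\<zero>\<^bsub>K\<^esub>"]) simp_all

text \<open>\<open>dense\<close> provides \<open>r\<close> in \<open>R\<close>, and
  \<open>r = e - c s\<close> lies in \<open>M\<close> because \<open>c\<close> does. Factors from
  \<open>M\<close> are thus traded for factors from \<open>m\<close> and multiples of
  \<open>c\<close>, both of which raise the level of \<open>F\<close>.\<close>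

lemma M_decomposition:
  assumes "e \<in> M"
  obtains r s where "r \<in> m" "s \<in> carrier S" "e = r \<oplus> c \<otimes> s"
proof -
  have e: "e \<in> carrier S"
    using assms M_ideal ideal.Icarr by fastforce
  obtain r s where rs: "r \<in> R" "s \<in> carrier S" "e = r \<oplus> c \<otimes> s"
    using e c_C by (auto intro: dense[of c e "\<zero>\<^bsub>K\<^esub>"])
  interpret I: ideal M S
    by (rule M_ideal)
  have "r = e \<ominus> c \<otimes> s"
    unfolding rs(3) using R_carrier[OF rs(1)] rs(2) c_S by algebra
  moreover have "c \<otimes> s \<in> M"
    using c_M rs(2) by (rule I.I_r_closed)
  ultimately have "r \<in> M"
    using assms by (simp add: a_minus_def)
  then show thesis
    using that rs by (simp add: m_def)
qed

text \<open>With the last factor written as \<open>r + c s\<close>, multiplication by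
  \<open>f r\<close> and by \<open>c\<close> each raises the level. The first component is zero, so
  \<open>\<delta> r\<close> never appears.\<close>

lemma F_smult_M_pow: "a \<in> M_pow n \<Longrightarrow> l \<in> carrier K \<Longrightarrow> F n \<zero> (a \<odot>\<^bsub>K\<^esub> l)"
proof (induction n arbitrary: a l)
  case 0
  then show ?case
    by (simp add: F_0)
next
  case (Suc n)
  from Suc.prems(1) show ?case
  proof (induction rule: ideal_power_Suc_induct)
    case (prod b e)
    obtain r s where e: "r \<in> m" "s \<in> carrier S" "e = r \<oplus> c \<otimes> s"
      using prod(2) by (rule M_decomposition)
    have b: "b \<in> carrier S"
      using prod(1) by (rule M_pow_S)
    have r: "r \<in> R"
      using e by (simp add: m_def)
    have "F (Suc n) \<zero> (r \<odot>\<^bsub>K\<^esub> (b \<odot>\<^bsub>K\<^esub> l))"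
      using F_Suc[OF Suc.IH[OF prod(1) Suc.prems(2)] e(1)] b r Suc.prems(2) by simp
    moreover have "F (Suc n) \<zero> (c \<odot>\<^bsub>K\<^esub> (b \<odot>\<^bsub>K\<^esub> (s \<odot>\<^bsub>K\<^esub> l)))"
      using F_c[OF Suc.IH[OF prod(1), of "s \<odot>\<^bsub>K\<^esub> l"]] b e(2) Suc.prems(2) by simp
    moreover have "(b \<otimes> e) \<odot>\<^bsub>K\<^esub> l = r \<odot>\<^bsub>K\<^esub> (b \<odot>\<^bsub>K\<^esub> l) \<oplus>\<^bsub>K\<^esub> c \<odot>\<^bsub>K\<^esub> (b \<odot>\<^bsub>K\<^esub> (s \<odot>\<^bsub>K\<^esub> l))"
      unfolding e(3) using b r e(2) Suc.prems(2) by (simp add: mac)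
    ultimately show ?case
      using F_add by fastforce
  next
    case (sum a b)
    then show ?case
      using F_add[of "Suc n" \<zero> "a \<odot>\<^bsub>K\<^esub> l" \<zero> "b \<odot>\<^bsub>K\<^esub> l"] sum.IH M_pow_S[OF sum.hyps(1)] M_pow_S[OF sum.hyps(2)] Suc.prems(2)
      by (simp add: smult_l_distr)
  qed
qed

text \<open>\<open>F_smult_M_pow\<close> covers the generators of \<open>N n\<close>, and the
  elements \<open>k\<close> with \<open>F n \<zero> k\<close> form a submodule.\<close>

lemma F_N:
  assumes "k \<in> N n"
  shows "F n \<zero> k"
proof -
  have "submodule {k \<in> carrier K. F n \<zero> k} S K"
  proof (rule submoduleI)
    show "\<ominus>\<^bsub>K\<^esub> x \<in> {k \<in> carrier K. F n \<zero> k}" if "x \<in> {k \<in> carrier K. F n \<zero> k}" for x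
      using that F_mult[of n \<zero> x "\<ominus> \<one>" "\<zero>\<^bsub>K\<^esub>"] by (simp add: smult_l_minus)
    show "a \<odot>\<^bsub>K\<^esub> x \<in> {k \<in> carrier K. F n \<zero> k}"
      if "a \<in> carrier S" "x \<in> {k \<in> carrier K. F n \<zero> k}" for a x
      using that F_mult[of n \<zero> x a "\<zero>\<^bsub>K\<^esub>"] by simp
    show "x \<oplus>\<^bsub>K\<^esub> y \<in> {k \<in> carrier K. F n \<zero> k}"
      if "x \<in> {k \<in> carrier K. F n \<zero> k}" "y \<in> {k \<in> carrier K. F n \<zero> k}" for x y
      using that F_add[of n \<zero> x \<zero> y] by simp
  qed (auto simp: F_zero)
  then have "N n \<subseteq> {k \<in> carrier K. F n \<zero> k}"
    by (rule ideal_power_module_minimal) (auto simp: F_smult_M_pow M_pow_S)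
  then show ?thesis
    using assms by blast
qed

text \<open>Multiplying \<open>(b, 0)\<close> by \<open>f r\<close> creates the second component
  \<open>b \<delta> r\<close>, which is removed by \<open>F_N\<close>. To do so at level
  \<open>n + 1\<close> the factor \<open>b\<close> must lie in
  \<open>M\<^sup>n\<^sup>+\<^sup>1\<close>, which is why the hypothesis is one power ahead.\<close>

lemma F_M_pow: "s \<in> M_pow (Suc n) \<Longrightarrow> F n s \<zero>\<^bsub>K\<^esub>"
proof (induction n arbitrary: s)
  case 0
  then show ?case
    using M_pow_S by (simp add: F_0)
next
  case (Suc n)
  from Suc.prems show ?case
  proof (induction rule: ideal_power_Suc_induct)
    case (prod b e)
    obtain r s where e: "r \<in> m" "s \<in> carrier S" "e = r \<oplus> c \<otimes> s"
      using prod(2) by (rule M_decomposition)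
    have b: "b \<in> carrier S"
      using prod(1) by (rule M_pow_S)
    have r: "r \<in> R"
      using e by (simp add: m_def)
    have "F (Suc n) (r \<otimes> b) (b \<odot>\<^bsub>K\<^esub> \<delta> r)"
      using F_Suc[OF Suc.IH[OF prod(1)] e(1)] b r by simp
    moreover have "F (Suc n) \<zero> (\<ominus>\<^bsub>K\<^esub> (b \<odot>\<^bsub>K\<^esub> \<delta> r))"
      using prod(1) r by (intro F_N N_minus smult_ideal_power_module) simp_all
    ultimately have "F (Suc n) (r \<otimes> b) \<zero>\<^bsub>K\<^esub>"
      using F_add[of "Suc n" "r \<otimes> b" "b \<odot>\<^bsub>K\<^esub> \<delta> r" \<zero> "\<ominus>\<^bsub>K\<^esub> (b \<odot>\<^bsub>K\<^esub> \<delta> r)"] b r by (simp add: M.r_neg)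
    moreover have "F (Suc n) (c \<otimes> (s \<otimes> b)) \<zero>\<^bsub>K\<^esub>"
      using F_c[OF F_mult[OF Suc.IH[OF prod(1)] e(2), of "\<zero>\<^bsub>K\<^esub>"]] b e(2) by simp
    moreover have "b \<otimes> e = r \<otimes> b \<oplus> c \<otimes> (s \<otimes> b)"
      unfolding e(3) using b r e(2) by (simp add: rac)
    ultimately show ?case
      using F_add by fastforce
  next
    case (sum a b)
    then show ?case
      using F_add[of "Suc n" a "\<zero>\<^bsub>K\<^esub>" b "\<zero>\<^bsub>K\<^esub>"] by simp
  qed
qed

text \<open>A converse, up to a shift, of \<open>m_pow_M_pow\<close> and \<open>delta_m_pow\<close>.
  From \<open>f r = f a + c\<^sup>n (v, w)\<close> it follows by \<open>divide_C\<close> that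
  \<open>v\<close> is in \<open>R\<close>, so \<open>r - a = c\<^sup>n v\<close> lies in
  \<open>m\<^sup>n\<close>.\<close>

lemma mem_m_pow:
  assumes "r \<in> R" "r \<in> M_pow (Suc n)" "\<delta> r \<in> N n"
  shows "r \<in> m_pow n"
proof -
  \<comment> \<open>Here \<open>f r\<close> is written as
    \<open>(r, 0) + (0, \<delta> r)\<close>.\<close>
  have "F n r (\<delta> r)"
    using F_add[OF F_M_pow[OF assms(2)] F_N[OF assms(3)]] assms(1) by simp
  then obtain a v w where a: "a \<in> m_pow n" "a \<in> R" "v \<in> carrier S" "w \<in> carrier K"
    "r = a \<oplus> c [^] n \<otimes> v" "\<delta> r = \<delta> a \<oplus>\<^bsub>K\<^esub> c [^] n \<odot>\<^bsub>K\<^esub> w"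
    by (rule FE)
  have "c [^] n \<otimes> v = \<ominus> a \<oplus> r"
    unfolding a(5) using R_carrier[OF a(2)] a(3) c_pow(2)[of n] by algebra
  then have R: "c [^] n \<otimes> v \<in> R"
    using a(2) assms(1) by simp
  then have "\<delta> a \<oplus>\<^bsub>K\<^esub> \<delta> (c [^] n \<otimes> v) = \<delta> a \<oplus>\<^bsub>K\<^esub> c [^] n \<odot>\<^bsub>K\<^esub> w"
    using a(2) a(6) delta_add[OF a(2) R] by (simp add: a(5))
  then have "\<delta> (c [^] n \<otimes> v) = c [^] n \<odot>\<^bsub>K\<^esub> w"
    using a(2,4) R by simp
  then have "v \<in> R"
    using divide_C(1)[of "c [^] n" v w] R a(3,4) by simp
  then have "c [^] n \<otimes> v \<in> m_pow n"
    using ideal.I_r_closed[OF R'.ideal_ideal_power[OF m_ideal] c_pow_m_pow] by fastforce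
  then show ?thesis
    using additive_subgroup.a_closed[OF ideal.axioms(1)[OF R'.ideal_ideal_power[OF m_ideal]] a(1)]
    by (simp add: a(5))
qed

text \<open>Apply \<open>dense\<close> to \<open>c\<^sup>n\<close>, which lies in
  \<open>m\<^sup>n\<close> and hence in \<open>M\<^sup>n\<close>.\<close>

lemma dense_adic:
  assumes "s \<in> carrier S" "k \<in> carrier K"
  obtains r where "r \<in> R" "s \<ominus> r \<in> M_pow n" "k \<ominus>\<^bsub>K\<^esub> \<delta> r \<in> N n"
proof -
  obtain r t l where r: "r \<in> R" "t \<in> carrier S" "l \<in> carrier K"
    "s = r \<oplus> c [^] n \<otimes> t" "k = \<delta> r \<oplus>\<^bsub>K\<^esub> c [^] n \<odot>\<^bsub>K\<^esub> l"
    using assms by (auto intro: dense[of "c [^] n" s k])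
  have c: "c [^] n \<in> M_pow n"
    by (simp add: c_pow_m_pow m_pow_M_pow)
  have "s \<ominus> r = c [^] n \<otimes> t"
    unfolding r(4) using R_carrier[OF r(1)] r(2) c_pow(2)[of n] by algebra
  then have "s \<ominus> r \<in> M_pow n"
    using ideal.I_r_closed[OF ideal_ideal_power[OF M_ideal] c r(2)] by simp
  moreover have "k \<ominus>\<^bsub>K\<^esub> \<delta> r = c [^] n \<odot>\<^bsub>K\<^esub> l"
    unfolding r(5) using r(1,3) by (simp add: M.minus_eq M.a_comm[of "\<delta> r"] M.a_assoc M.r_neg)
  then have "k \<ominus>\<^bsub>K\<^esub> \<delta> r \<in> N n"
    using smult_ideal_power_module[OF c r(3)] by simp
  ultimately show thesis
    using that r(1) by blast
qed

end

section \<open>Cosets and inverses modulo a maximal ideal\<close>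

lemma (in abelian_subgroup) a_rcosets_nonempty:
  assumes "X \<in> a_rcosets H"
  obtains x where "x \<in> X"
  using assms a_rcos_self unfolding A_RCOSETS_def' by blast

lemma (in abelian_subgroup) a_rcosets_rep:
  assumes "X \<in> a_rcosets H" "x \<in> X"
  shows "x \<in> carrier G" "X = H +> x"
  using assms a_elemrcos_carrier a_repr_independence' unfolding A_RCOSETS_def' by blast+

lemma (in abelian_subgroup) a_rcos_eq_iff:
  assumes "x \<in> carrier G" "y \<in> carrier G"
  shows "H +> x = H +> y \<longleftrightarrow> x \<ominus> y \<in> H"
  using assms a_rcos_module a_rcos_self a_repr_independence' unfolding a_minus_def by metis

lemma a_rcos_mono: "H \<subseteq> H' \<Longrightarrow> H +>\<^bsub>G\<^esub> x \<subseteq> H' +>\<^bsub>G\<^esub> x"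
  unfolding a_r_coset_def' by blast

lemma (in ideal) abelian_subgroup: "abelian_subgroup I R"
  by (rule abelian_subgroup_axioms)

lemma (in ideal) rcoset_mult_mem:
  assumes "X \<in> a_rcosets I" "Y \<in> a_rcosets I" "x \<in> X" "y \<in> Y"
  shows "[mod I:] X \<Otimes> Y = I +> x \<otimes> y"
  using a_rcosets_rep[OF assms(1,3)] a_rcosets_rep[OF assms(2,4)] rcoset_mult_add by metis

lemma (in abelian_subgroup) set_add_mem:
  assumes "X \<in> a_rcosets H" "Y \<in> a_rcosets H" "x \<in> X" "y \<in> Y"
  shows "X <+> Y = H +> x \<oplus> y"
  using a_rcosets_rep[OF assms(1,3)] a_rcosets_rep[OF assms(2,4)] a_rcos_sum by metis

text \<open>By maximality, \<open>I\<close> and \<open>a\<close> together generate the unit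
  ideal.\<close>

lemma maximalideal_inverse:
  fixes A :: "('a, 'm) ring_scheme" (structure)
  assumes "cring A" "maximalideal I A" "a \<in> carrier A" "a \<notin> I"
  obtains e b where "e \<in> I" "b \<in> carrier A" "\<one> = e \<oplus> b \<otimes> a"
proof -
  interpret cring A
    by fact
  interpret maximalideal I A
    by fact
  define J :: "'a set" where "J = I <+>\<^bsub>A\<^esub> PIdl a"
  interpret P: ideal "PIdl a" A
    using assms(3) by (rule cgenideal_ideal)
  have J: "ideal J A"
    unfolding J_def by (rule add_ideals[OF is_ideal P.is_ideal])
  have mem_J: "e \<oplus> b \<otimes> a \<in> J" if "e \<in> I" "b \<in> carrier A" for e b
    using that unfolding J_def set_add_def' cgenideal_def by blast
  have "I \<subseteq> J"
    using mem_J[of _ \<zero>] assms(3) by fastforce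
  moreover have "a \<in> J"
    using mem_J[of \<zero> \<one>] assms(3) by simp
  ultimately have "\<one> \<in> J"
    using I_maximal[OF J] assms(4) ideal.Icarr[OF J] by auto
  then show thesis
    using that unfolding J_def set_add_def' cgenideal_def by blast
qed

section \<open>Completions\<close>

context adic_twisted_subring
begin

lemma M_pow_subgroup: "abelian_subgroup (M_pow n) S"
  by (rule ideal.abelian_subgroup[OF ideal_ideal_power[OF M_ideal]])

lemma m_pow_subgroup: "abelian_subgroup (m_pow n) R'"
  by (rule ideal.abelian_subgroup[OF R'.ideal_ideal_power[OF m_ideal]])

lemma N_subgroup: "abelian_subgroup (N n) K"
  using submodule.axioms(1)[OF ideal_power_module_submodule[OF M_ideal]]
  by (intro abelian_subgroupI3 additive_subgroup.intro M.abelian_group_axioms)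

lemma minus_R' [simp]: "r \<in> R \<Longrightarrow> s \<in> R \<Longrightarrow> r \<ominus>\<^bsub>R'\<^esub> s = r \<ominus> s"
  by (simp add: a_minus_def)

lemma minus_R [simp]: "r \<in> R \<Longrightarrow> s \<in> R \<Longrightarrow> r \<ominus> s \<in> R"
  by (simp add: a_minus_def)

lemma delta_minus:
  assumes "r \<in> R" "s \<in> R"
  shows "\<delta> (r \<ominus> s) = \<delta> r \<ominus>\<^bsub>K\<^esub> \<delta> s"
proof -
  have "r = (r \<ominus> s) \<oplus> s"
    using R_carrier[OF assms(1)] R_carrier[OF assms(2)] by algebra
  then have "\<delta> r = \<delta> (r \<ominus> s) \<oplus>\<^bsub>K\<^esub> \<delta> s"
    using delta_add[of "r \<ominus> s" s] assms by simp
  then show ?thesis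
    using assms by (simp add: M.minus_eq M.a_assoc M.r_neg)
qed

lemma twist_map_eq: "twist_map S K C D r = (r, \<delta> r)"
  by (simp add: twist_map_def \<delta>_def)

lemma twist_map_hom: "twist_map S K C D \<in> ring_hom R' (idealization S K)"
  by (rule ring_hom_memI)
    (auto simp: twist_map_eq idealization_def delta_add delta_mult delta_C)

text \<open>This makes \<open>lift\<close> well defined: a coset of
  \<open>m\<^sup>n\<^sup>+\<^sup>1\<close> determines both components at level
  \<open>n\<close>.\<close>

lemma m_pow_coset_imp:
  assumes "r \<in> R" "s \<in> R" "r \<ominus> s \<in> m_pow (Suc n)"
  shows "M_pow n +> r = M_pow n +> s" "N n +>\<^bsub>K\<^esub> \<delta> r = N n +>\<^bsub>K\<^esub> \<delta> s"
proof -
  have "r \<ominus> s \<in> M_pow n"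
    using m_pow_M_pow[OF assms(3)] ideal_power_antimono[OF M_ideal] by blast
  then show "M_pow n +> r = M_pow n +> s"
    using assms by (simp add: abelian_subgroup.a_rcos_eq_iff[OF M_pow_subgroup])
  show "N n +>\<^bsub>K\<^esub> \<delta> r = N n +>\<^bsub>K\<^esub> \<delta> s"
    using delta_m_pow[OF assms(3)] assms(1,2)
    by (simp add: abelian_subgroup.a_rcos_eq_iff[OF N_subgroup] delta_minus)
qed

text \<open>This serves both injectivity and surjectivity of \<open>lift\<close>. Both components
  are compared at level \<open>n + 1\<close>, and the inclusion of \<open>N (Suc n)\<close> in
  \<open>N n\<close> brings the second to the level used in \<open>mem_m_pow\<close>.\<close>

lemma m_pow_coset_eqI:
  assumes "r \<in> R" "s \<in> R"
    and "M_pow (Suc n) +> r = M_pow (Suc n) +> s" "N (Suc n) +>\<^bsub>K\<^esub> \<delta> r = N (Suc n) +>\<^bsub>K\<^esub> \<delta> s"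
  shows "m_pow n +>\<^bsub>R'\<^esub> r = m_pow n +>\<^bsub>R'\<^esub> s"
proof -
  have "r \<ominus> s \<in> M_pow (Suc n)"
    using assms by (simp add: abelian_subgroup.a_rcos_eq_iff[OF M_pow_subgroup])
  moreover have "\<delta> (r \<ominus> s) \<in> N n"
    using assms ideal_power_module_antimono[OF M_ideal]
    by (auto simp: abelian_subgroup.a_rcos_eq_iff[OF N_subgroup] delta_minus)
  ultimately have "r \<ominus> s \<in> m_pow n"
    using assms by (intro mem_m_pow) simp_all
  then show ?thesis
    using assms by (simp add: abelian_subgroup.a_rcos_eq_iff[OF m_pow_subgroup])
qed

text \<open>With \<open>a = h + s\<close> and \<open>l = g + k\<close>, the difference
  \<open>a l - s k = h l + s g\<close> lies in \<open>N n\<close>, so the union defining scalar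
  multiplication runs over a constant family.\<close>

lemma smult_cosets:
  assumes "s \<in> carrier S" "k \<in> carrier K"
  shows "(\<Union>a\<in>M_pow n +> s. \<Union>l\<in>N n +>\<^bsub>K\<^esub> k. N n +>\<^bsub>K\<^esub> (a \<odot>\<^bsub>K\<^esub> l)) = N n +>\<^bsub>K\<^esub> (s \<odot>\<^bsub>K\<^esub> k)"
proof -
  have eq: "N n +>\<^bsub>K\<^esub> (a \<odot>\<^bsub>K\<^esub> l) = N n +>\<^bsub>K\<^esub> (s \<odot>\<^bsub>K\<^esub> k)"
    if al: "a \<in> M_pow n +> s" "l \<in> N n +>\<^bsub>K\<^esub> k" for a l
  proof -
    obtain h where h: "h \<in> M_pow n" "a = h \<oplus> s"
      using al(1) unfolding a_r_coset_def' by blast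
    obtain g where g: "g \<in> N n" "l = g \<oplus>\<^bsub>K\<^esub> k"
      using al(2) unfolding a_r_coset_def' by blast
    have carr: "h \<in> carrier S" "g \<in> carrier K"
      using h g M_pow_S N_K by auto
    have "a \<odot>\<^bsub>K\<^esub> l \<ominus>\<^bsub>K\<^esub> s \<odot>\<^bsub>K\<^esub> k = h \<odot>\<^bsub>K\<^esub> l \<oplus>\<^bsub>K\<^esub> s \<odot>\<^bsub>K\<^esub> g"
      using assms carr h(2) g(2) by (simp add: smult_l_distr smult_r_distr M.minus_eq M.a_assoc M.r_neg
          M.a_comm[of "s \<odot>\<^bsub>K\<^esub> g"] M.r_neg2)
    moreover have "h \<odot>\<^bsub>K\<^esub> l \<in> N n"
      using h(1) g(2) assms(2) carr(2) by (intro smult_ideal_power_module) simp_all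
    ultimately have "a \<odot>\<^bsub>K\<^esub> l \<ominus>\<^bsub>K\<^esub> s \<odot>\<^bsub>K\<^esub> k \<in> N n"
      using N_add N_smult[OF assms(1) g(1)] by simp
    then show ?thesis
      using assms carr h(2) g(2) by (simp add: abelian_subgroup.a_rcos_eq_iff[OF N_subgroup])
  qed
  have "s \<in> M_pow n +> s" "k \<in> N n +>\<^bsub>K\<^esub> k"
    using assms abelian_subgroup.a_rcos_self[OF M_pow_subgroup]
      abelian_subgroup.a_rcos_self[OF N_subgroup] by auto
  then show ?thesis
    by (intro UN_const_eq eq) auto
qed

section \<open>The lift of \<open>f\<close> to the completions\<close>

abbreviation "R_hat \<equiv> ring_completion R' m"
abbreviation "S_hat \<equiv> ring_completion S M"
abbreviation "K_hat \<equiv> module_completion S K M"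

text \<open>The shift by one is forced by \<open>\<delta> (m\<^sup>n\<^sup>+\<^sup>1) \<subseteq> M\<^sup>n K\<close>.\<close>

definition "lift x =
  (\<lambda>n. M_pow n +> (SOME r. r \<in> x (Suc n)), \<lambda>n. N n +>\<^bsub>K\<^esub> \<delta> (SOME r. r \<in> x (Suc n)))"

text \<open>Independence of the chosen representative; each later argument picks the one that suits
  it.\<close>

lemma lift_eq:
  assumes "x (Suc n) \<in> a_rcosets\<^bsub>R'\<^esub> (m_pow (Suc n))" "r \<in> x (Suc n)"
  shows "fst (lift x) n = M_pow n +> r" "snd (lift x) n = N n +>\<^bsub>K\<^esub> \<delta> r"
proof -
  interpret abelian_subgroup "m_pow (Suc n)" R'
    by (rule m_pow_subgroup)
  define s where "s = (SOME r. r \<in> x (Suc n))"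
  have s: "s \<in> x (Suc n)"
    unfolding s_def using assms(2) by (rule someI)
  have R: "r \<in> R" "s \<in> R"
    using a_rcosets_rep(1)[OF assms] a_rcosets_rep(1)[OF assms(1) s] by auto
  have "m_pow (Suc n) +>\<^bsub>R'\<^esub> s = m_pow (Suc n) +>\<^bsub>R'\<^esub> r"
    using a_rcosets_rep(2)[OF assms] a_rcosets_rep(2)[OF assms(1) s] by simp
  then have "s \<ominus> r \<in> m_pow (Suc n)"
    using R a_rcos_eq_iff by simp
  then show "fst (lift x) n = M_pow n +> r" "snd (lift x) n = N n +>\<^bsub>K\<^esub> \<delta> r"
    using m_pow_coset_imp[OF R(2,1)] by (simp_all add: lift_def s_def)
qed

lemma R_hatD:
  assumes "x \<in> carrier R_hat"
  shows "x n \<in> a_rcosets\<^bsub>R'\<^esub> (m_pow n)" "x (Suc n) \<subseteq> x n"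
  using assms by (auto simp: ring_completion_def FactRing_def)

lemma R_hat_rep:
  assumes "x \<in> carrier R_hat"
  obtains r where "r \<in> R" "r \<in> x n"
proof -
  interpret m: abelian_subgroup "m_pow n" R'
    by (rule m_pow_subgroup)
  obtain r where "r \<in> x n"
    using R_hatD(1)[OF assms] by (rule m.a_rcosets_nonempty)
  then show thesis
    using that m.a_rcosets_rep(1)[OF R_hatD(1)[OF assms]] by simp
qed

lemma lift_closed:
  assumes "x \<in> carrier R_hat"
  shows "lift x \<in> carrier S_hat \<times> carrier K_hat"
proof -
  have "fst (lift x) n \<in> a_rcosets (M_pow n) \<and> fst (lift x) (Suc n) \<subseteq> fst (lift x) n \<and>
      snd (lift x) n \<in> a_rcosets\<^bsub>K\<^esub> (N n) \<and> snd (lift x) (Suc n) \<subseteq> snd (lift x) n" for n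
  proof -
    \<comment> \<open>A representative of \<open>x (n + 2)\<close> also represents
      \<open>x (n + 1)\<close>, so a single \<open>r\<close> computes levels \<open>n + 1\<close>
      and \<open>n\<close> of the lift.\<close>
    obtain r where r: "r \<in> R" "r \<in> x (Suc (Suc n))"
      using assms by (rule R_hat_rep)
    have r': "r \<in> x (Suc n)"
      using r(2) R_hatD(2)[OF assms] by blast
    have "M_pow n \<subseteq> carrier S" "N n \<subseteq> carrier K" for n
      using M_pow_S N_K by blast+
    then show ?thesis
      using r(1)
      by (simp add: a_rcos_mono ideal_power_antimono[OF M_ideal] ideal_power_module_antimono[OF M_ideal] lift_eq[of x "Suc n" r, OF R_hatD(1)[OF assms] r(2)] lift_eq[of x n r, OF R_hatD(1)[OF assms] r']
          R.a_rcosetsI M.a_rcosetsI)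
  qed
  then show ?thesis
    by (cases "lift x") (simp add: ring_completion_def module_completion_def FactRing_def)
qed

lemma lift_add:
  assumes "x \<in> carrier R_hat" "y \<in> carrier R_hat"
  shows "lift (x \<oplus>\<^bsub>R_hat\<^esub> y) = lift x \<oplus>\<^bsub>idealization S_hat K_hat\<^esub> lift y"
proof -
  let ?z = "x \<oplus>\<^bsub>R_hat\<^esub> y"
  have "fst (lift ?z) n = fst (lift x) n <+>\<^bsub>S\<^esub> fst (lift y) n \<and>
      snd (lift ?z) n = snd (lift x) n <+>\<^bsub>K\<^esub> snd (lift y) n" for n
  proof -
    interpret m: abelian_subgroup "m_pow (Suc n)" R'
      by (rule m_pow_subgroup)
    obtain r s where r: "r \<in> R" "r \<in> x (Suc n)" and s: "s \<in> R" "s \<in> y (Suc n)"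
      using assms by (metis R_hat_rep)
    have "?z (Suc n) = m_pow (Suc n) +>\<^bsub>R'\<^esub> (r \<oplus> s)"
      using m.set_add_mem[OF R_hatD(1)[OF assms(1), of "Suc n"] R_hatD(1)[OF assms(2), of "Suc n"] r(2) s(2)]
      by (simp add: ring_completion_def FactRing_def)
    moreover have "r \<oplus> s \<in> carrier R'"
      using r s by simp
    ultimately have "?z (Suc n) \<in> a_rcosets\<^bsub>R'\<^esub> (m_pow (Suc n))" "r \<oplus> s \<in> ?z (Suc n)"
      using R'.a_rcosetsI[OF m.a_subset] m.a_rcos_self by simp_all
    then show ?thesis
      using lift_eq[of x n r, OF R_hatD(1)[OF assms(1)] r(2)] lift_eq[of y n s, OF R_hatD(1)[OF assms(2)] s(2)] r(1) s(1)
      by (simp add: lift_eq[of ?z n "r \<oplus> s"] delta_add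
          abelian_subgroup.a_rcos_sum[OF M_pow_subgroup] abelian_subgroup.a_rcos_sum[OF N_subgroup])
  qed
  then show ?thesis
    by (simp add: prod_eq_iff fun_eq_iff idealization_def case_prod_unfold ring_completion_def
        module_completion_def FactRing_def)
qed

text \<open>On representatives the second component is \<open>r \<delta> s + s \<delta> r\<close>,
  which is at once the Leibniz rule and the product in the idealization.\<close>

lemma lift_mult:
  assumes "x \<in> carrier R_hat" "y \<in> carrier R_hat"
  shows "lift (x \<otimes>\<^bsub>R_hat\<^esub> y) = lift x \<otimes>\<^bsub>idealization S_hat K_hat\<^esub> lift y"
proof -
  let ?z = "x \<otimes>\<^bsub>R_hat\<^esub> y"
  have "fst (lift ?z) n = rcoset_mult S (M_pow n) (fst (lift x) n) (fst (lift y) n) \<and>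
      snd (lift ?z) n =
        (\<Union>a\<in>fst (lift x) n. \<Union>l\<in>snd (lift y) n. N n +>\<^bsub>K\<^esub> (a \<odot>\<^bsub>K\<^esub> l)) <+>\<^bsub>K\<^esub>
        (\<Union>a\<in>fst (lift y) n. \<Union>l\<in>snd (lift x) n. N n +>\<^bsub>K\<^esub> (a \<odot>\<^bsub>K\<^esub> l))" for n
  proof -
    interpret m: ideal "m_pow (Suc n)" R'
      by (rule R'.ideal_ideal_power[OF m_ideal])
    obtain r s where r: "r \<in> R" "r \<in> x (Suc n)" and s: "s \<in> R" "s \<in> y (Suc n)"
      using assms by (metis R_hat_rep)
    have "?z (Suc n) = m_pow (Suc n) +>\<^bsub>R'\<^esub> (r \<otimes> s)"
      using m.rcoset_mult_mem[OF R_hatD(1)[OF assms(1), of "Suc n"] R_hatD(1)[OF assms(2), of "Suc n"] r(2) s(2)]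
      by (simp add: ring_completion_def FactRing_def)
    moreover have "r \<otimes> s \<in> carrier R'"
      using r s by simp
    ultimately have "?z (Suc n) \<in> a_rcosets\<^bsub>R'\<^esub> (m_pow (Suc n))" "r \<otimes> s \<in> ?z (Suc n)"
      using R'.a_rcosetsI[OF m.a_subset] m.a_rcos_self by simp_all
    then show ?thesis
      using lift_eq[of x n r, OF R_hatD(1)[OF assms(1)] r(2)] lift_eq[of y n s, OF R_hatD(1)[OF assms(2)] s(2)] r(1) s(1)
      by (simp add: lift_eq[of ?z n "r \<otimes> s"] delta_mult smult_cosets
          ideal.rcoset_mult_add[OF ideal_ideal_power[OF M_ideal]] abelian_subgroup.a_rcos_sum[OF N_subgroup])
  qed
  then show ?thesis
    by (simp add: prod_eq_iff fun_eq_iff idealization_def case_prod_unfold ring_completion_def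
        module_completion_def FactRing_def)
qed

text \<open>The commuting square expressing that \<open>lift\<close> extends \<open>f\<close>; it
  also gives the value at the identity.\<close>

lemma lift_to_completion:
  assumes "r \<in> R"
  shows "lift (to_ring_completion R' m r) =
    (to_ring_completion S M r, to_module_completion S K M (\<delta> r))"
proof -
  have "fst (lift (to_ring_completion R' m r)) n = M_pow n +> r \<and>
      snd (lift (to_ring_completion R' m r)) n = N n +>\<^bsub>K\<^esub> \<delta> r" for n
  proof -
    interpret m: abelian_subgroup "m_pow (Suc n)" R'
      by (rule m_pow_subgroup)
    show ?thesis
      using lift_eq[of "to_ring_completion R' m r" n r] R'.a_rcosetsI[OF m.a_subset] m.a_rcos_self assms
      by (simp add: to_ring_completion_def)
  qed
  then show ?thesis
    by (simp add: prod_eq_iff fun_eq_iff to_ring_completion_def to_module_completion_def)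
qed

lemma lift_one: "lift \<one>\<^bsub>R_hat\<^esub> = \<one>\<^bsub>idealization S_hat K_hat\<^esub>"
proof -
  have "\<one>\<^bsub>R_hat\<^esub> = to_ring_completion R' m \<one>"
    by (simp add: ring_completion_def to_ring_completion_def FactRing_def)
  moreover have "N n +>\<^bsub>K\<^esub> \<zero>\<^bsub>K\<^esub> = N n" for n
    using N_K by (intro M.a_coset_add_zero) blast
  ultimately show ?thesis
    using lift_to_completion[of \<one>]
    by (simp add: delta_C ring_completion_def module_completion_def to_ring_completion_def
        to_module_completion_def FactRing_def idealization_def)
qed

lemma lift_inj: "inj_on lift (carrier R_hat)"
proof (rule inj_onI, rule ext)
  fix x y n
  assume xy: "x \<in> carrier R_hat" "y \<in> carrier R_hat" and eq: "lift x = lift y"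
  \<comment> \<open>Two shifts add up: \<open>lift\<close> at level \<open>n + 1\<close> is read off
    from \<open>x (n + 2)\<close>, and agreement at level \<open>n + 1\<close> gives a congruence
    modulo \<open>m\<^sup>n\<close>.\<close>
  obtain r s where r: "r \<in> R" "r \<in> x (Suc (Suc n))" and s: "s \<in> R" "s \<in> y (Suc (Suc n))"
    using xy by (metis R_hat_rep)
  have "r \<in> x n" "s \<in> y n"
    using r s R_hatD(2) xy by blast+
  then have "x n = m_pow n +>\<^bsub>R'\<^esub> r" "y n = m_pow n +>\<^bsub>R'\<^esub> s"
    using abelian_subgroup.a_rcosets_rep(2)[OF m_pow_subgroup R_hatD(1)] xy by blast+
  moreover have "m_pow n +>\<^bsub>R'\<^esub> r = m_pow n +>\<^bsub>R'\<^esub> s"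
    using lift_eq[of x "Suc n" r, OF R_hatD(1)[OF xy(1)] r(2)] lift_eq[of y "Suc n" s, OF R_hatD(1)[OF xy(2)] s(2)] eq r(1) s(1)
    by (intro m_pow_coset_eqI) simp_all
  ultimately show "x n = y n"
    by simp
qed

text \<open>By \<open>dense_adic\<close> each pair \<open>(y n, z n)\<close> is represented by some
  \<open>f (\<rho> n)\<close>; the \<open>\<rho> n\<close>, shifted by one, form a compatible
  sequence in \<open>R\<close>.\<close>

lemma lift_surj:
  assumes "y \<in> carrier S_hat" "z \<in> carrier K_hat"
  obtains x where "x \<in> carrier R_hat" "lift x = (y, z)"
proof -
  have y: "y n \<in> a_rcosets (M_pow n)" "y (Suc n) \<subseteq> y n"
    and z: "z n \<in> a_rcosets\<^bsub>K\<^esub> (N n)" "z (Suc n) \<subseteq> z n" for n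
    using assms by (auto simp: ring_completion_def module_completion_def FactRing_def)
  have "\<exists>r. r \<in> R \<and> r \<in> y n \<and> \<delta> r \<in> z n" for n
  proof -
    obtain s where s: "s \<in> y n"
      using abelian_subgroup.a_rcosets_nonempty[OF M_pow_subgroup y(1)] by blast
    obtain k where k: "k \<in> z n"
      using abelian_subgroup.a_rcosets_nonempty[OF N_subgroup z(1)] by blast
    note s' = abelian_subgroup.a_rcosets_rep[OF M_pow_subgroup y(1) s]
    note k' = abelian_subgroup.a_rcosets_rep[OF N_subgroup z(1) k]
    obtain r where r: "r \<in> R" "s \<ominus> r \<in> M_pow n" "k \<ominus>\<^bsub>K\<^esub> \<delta> r \<in> N n"
      using s'(1) k'(1) by (rule dense_adic)
    have "y n = M_pow n +> r"
      using s' r by (simp add: abelian_subgroup.a_rcos_eq_iff[OF M_pow_subgroup])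
    moreover have "z n = N n +>\<^bsub>K\<^esub> \<delta> r"
      using k' r by (simp add: abelian_subgroup.a_rcos_eq_iff[OF N_subgroup])
    ultimately show ?thesis
      using r(1) abelian_subgroup.a_rcos_self[OF M_pow_subgroup, of r n]
        abelian_subgroup.a_rcos_self[OF N_subgroup, of "\<delta> r" n] by auto
  qed
  then obtain \<rho> where \<rho>: "\<And>n. \<rho> n \<in> R" "\<And>n. \<rho> n \<in> y n" "\<And>n. \<delta> (\<rho> n) \<in> z n"
    by metis
  have \<rho>_Suc: "\<rho> (Suc n) \<in> y n" "\<delta> (\<rho> (Suc n)) \<in> z n" for n
    using \<rho>(2,3)[of "Suc n"] y(2) z(2) by blast+
  \<comment> \<open>The index \<open>n + 1\<close> is needed for compatibility: agreement at level
    \<open>n + 1\<close> is what \<open>m_pow_coset_eqI\<close> turns into a congruence modulo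
    \<open>m\<^sup>n\<close>.\<close>
  define x where "x n = m_pow n +>\<^bsub>R'\<^esub> \<rho> (Suc n)" for n
  have rep: "x n \<in> a_rcosets\<^bsub>R'\<^esub> (m_pow n)" "\<rho> (Suc n) \<in> x n" for n
    using abelian_subgroup.a_rcos_self[OF m_pow_subgroup, of "\<rho> (Suc n)" n] \<rho>(1)
    by (auto simp: x_def A_RCOSETS_def')
  have "x (Suc n) \<subseteq> x n" for n
  proof -
    have "M_pow (Suc n) +> \<rho> (Suc (Suc n)) = M_pow (Suc n) +> \<rho> (Suc n)"
      using abelian_subgroup.a_rcosets_rep(2)[OF M_pow_subgroup y(1)] \<rho>_Suc(1) \<rho>(2) by metis
    moreover have "N (Suc n) +>\<^bsub>K\<^esub> \<delta> (\<rho> (Suc (Suc n))) = N (Suc n) +>\<^bsub>K\<^esub> \<delta> (\<rho> (Suc n))"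
      using abelian_subgroup.a_rcosets_rep(2)[OF N_subgroup z(1)] \<rho>_Suc(2) \<rho>(3) by metis
    ultimately have "m_pow n +>\<^bsub>R'\<^esub> \<rho> (Suc (Suc n)) = x n"
      unfolding x_def using \<rho>(1) by (intro m_pow_coset_eqI) simp_all
    then show ?thesis
      using a_rcos_mono[OF R'.ideal_power_antimono[OF m_ideal]] unfolding x_def by metis
  qed
  then have "x \<in> carrier R_hat"
    using rep(1) by (simp add: ring_completion_def FactRing_def)
  \<comment> \<open>Level \<open>n\<close> of the lift comes from \<open>x (n + 1)\<close>,
    represented by \<open>\<rho> (n + 2)\<close>. This lies in \<open>y (n + 1)\<close>, hence in
    \<open>y n\<close>, and its derivative likewise in \<open>z n\<close>.\<close>
  moreover have "fst (lift x) n = y n \<and> snd (lift x) n = z n" for n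
    using lift_eq[of x n "\<rho> (Suc (Suc n))", OF rep] y(2)[of n] z(2)[of n] \<rho>_Suc[of "Suc n"]
      abelian_subgroup.a_rcosets_rep(2)[OF M_pow_subgroup y(1), of "\<rho> (Suc (Suc n))" n]
      abelian_subgroup.a_rcosets_rep(2)[OF N_subgroup z(1), of "\<delta> (\<rho> (Suc (Suc n)))" n]
    by auto
  then have "lift x = (y, z)"
    by (simp add: prod_eq_iff fun_eq_iff)
  ultimately show thesis
    by (rule that)
qed

lemma lift_iso: "lift \<in> ring_iso R_hat (idealization S_hat K_hat)"
proof -
  have carrier: "carrier (idealization S_hat K_hat) = carrier S_hat \<times> carrier K_hat"
    by (simp add: idealization_def)
  have "lift \<in> ring_hom R_hat (idealization S_hat K_hat)"
    by (rule ring_hom_memI) (simp_all add: lift_closed lift_mult lift_add lift_one carrier)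
  moreover have "lift ` carrier R_hat = carrier S_hat \<times> carrier K_hat"
  proof
    show "carrier S_hat \<times> carrier K_hat \<subseteq> lift ` carrier R_hat"
    proof
      fix p
      assume "p \<in> carrier S_hat \<times> carrier K_hat"
      then obtain x where "x \<in> carrier R_hat" "lift x = p"
        using lift_surj[of "fst p" "snd p"] by (auto simp: mem_Times_iff)
      then show "p \<in> lift ` carrier R_hat"
        by blast
    qed
  qed (use lift_closed in blast)
  ultimately show ?thesis
    using lift_inj by (simp add: ring_iso_def bij_betw_def carrier)
qed

text \<open>For \<open>r\<close> in \<open>J\<close> outside \<open>M\<close>, an inverse
  \<open>b\<close> of \<open>r\<close> modulo \<open>M\<close> can be changed by a multiple of
  \<open>c\<close> into an element \<open>s\<close> of \<open>R\<close>. Then \<open>1 - s r\<close>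
  lies in \<open>m\<close>, hence in \<open>J\<close>, and so \<open>1\<close> is in
  \<open>J\<close>.\<close>

lemma m_maximal:
  assumes "maximalideal M S"
  shows "maximalideal m R'"
proof (rule maximalidealI)
  interpret I: maximalideal M S
    by fact
  show "carrier R' \<noteq> m"
  proof
    assume eq: "carrier R' = m"
    have "\<one> \<in> carrier R'"
      by simp
    then have "\<one> \<in> M"
      unfolding eq m_def by blast
    then show False
      using I.I_notcarr I.one_imp_carrier by blast
  qed
  fix J
  assume J: "ideal J R'" and sub: "m \<subseteq> J" and JR: "J \<subseteq> carrier R'"
  interpret J: ideal J R'
    by fact
  show "J = m \<or> J = carrier R'"
  proof (cases "J \<subseteq> M")
    case True
    then show ?thesis
      using sub JR by (auto simp: m_def)
  next
    case False
    then obtain r where r: "r \<in> J" "r \<notin> M" "r \<in> R"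
      using JR by auto
    obtain e b where e: "e \<in> M" "b \<in> carrier S" "\<one> = e \<oplus> b \<otimes> r"
      using maximalideal_inverse[OF R.is_cring assms R_carrier[OF r(3)] r(2)] by blast
    obtain s t where s: "s \<in> R" "t \<in> carrier S" "b = s \<oplus> c \<otimes> t"
      using e(2) c_C by (auto intro: dense[of c b "\<zero>\<^bsub>K\<^esub>"])
    have carr: "e \<in> carrier S" "s \<in> carrier S" "r \<in> carrier S"
      using e(1) s(1) r(3) by auto
    have "\<one> \<ominus> s \<otimes> r = (e \<oplus> b \<otimes> r) \<ominus> s \<otimes> r"
      using e(3) by simp
    also have "\<dots> = e \<oplus> c \<otimes> (t \<otimes> r)"
      unfolding s(3) using carr s(2) c_S by algebra
    finally have "\<one> \<ominus> s \<otimes> r \<in> M"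
      using I.I_r_closed[OF c_M] e(1) s(2) carr by simp
    then have "\<one> \<ominus> s \<otimes> r \<in> J"
      using sub s(1) r(3) by (auto simp: m_def)
    moreover have "s \<otimes> r \<in> J"
      using J.I_l_closed[OF r(1)] s(1) by simp
    ultimately have "(\<one> \<ominus> s \<otimes> r) \<oplus> s \<otimes> r \<in> J"
      using J.a_closed by fastforce
    moreover have "(\<one> \<ominus> s \<otimes> r) \<oplus> s \<otimes> r = \<one>"
      using carr by algebra
    ultimately show ?thesis
      using J.one_imp_carrier by simp
  qed
qed (rule m_ideal)

end

theorem corollary4p7:
  fixes S :: "('a, 'm) ring_scheme"
    and K :: "('a, 'b, 'n) module_scheme"
    and C R mR mS :: "'a set"
    and D :: "('a \<times> 'a) set \<Rightarrow> ('b \<times> 'a) set"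
  assumes "cring S"
    and "submonoid C S" and "C \<subseteq> ring_nonzerodivisors S"
    and "module S K" and "torsion_free C K"
    and "subring R S" and "twists S K C R D"
    and "quasilocal (S\<lparr>carrier := R\<rparr>)" and "maximalideal mR (S\<lparr>carrier := R\<rparr>)"
    and "fg_ideal (S\<lparr>carrier := R\<rparr>) mR" and "mR \<inter> C \<noteq> {}"
    and "quasilocal S" and "maximalideal mS S"
    and "fg_ideal S mS" and "mS \<inter> C \<noteq> {}"
  shows "twist_map S K C D \<in> ring_hom (S\<lparr>carrier := R\<rparr>) (idealization S K) \<and>
    (\<exists>\<phi> \<in> ring_iso (ring_completion (S\<lparr>carrier := R\<rparr>) mR)
              (idealization (ring_completion S mS) (module_completion S K mS)).
       \<forall>r\<in>R. \<phi> (to_ring_completion (S\<lparr>carrier := R\<rparr>) mR r) =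
         map_prod (to_ring_completion S mS) (to_module_completion S K mS) (twist_map S K C D r))"
proof -
  obtain c where "c \<in> mS" "c \<in> C"
    using \<open>mS \<inter> C \<noteq> {}\<close> by blast
  then interpret adic_twisted_subring S K C R D mS c
    using assms
    by (simp add: adic_twisted_subring_def adic_twisted_subring_axioms_def twisted_subring_def
        twisted_subring_axioms_def torsion_free_module_def torsion_free_module_axioms_def
        maximalideal.axioms(1))
  \<comment> \<open>Both are maximal ideals of \<open>R\<close>, which is quasilocal.\<close>
  have "mR = m"
    using assms(8,9) m_maximal[OF assms(13)] unfolding quasilocal_def by blast
  then show ?thesis
    using twist_map_hom lift_iso lift_to_completion by (auto simp: twist_map_eq)
qed

end
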